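(* Let $C \subseteq \mathbb{R}^2$ be the $1$-dimensional attractor (i.e. $\dim(C)=1$) of an iterated function system that satisfies the open set condition. Then there exist constants $b_1, b_2$ (independent of $\varepsilon$) such that for every $\varepsilon>0$ there exists a Lipschitz graph $\Gamma$ that satisfies $$\dim(C \cap \Gamma) \geq 1-\varepsilon$$ and $$\operatorname{Lip}(\Gamma) \leq b_1\exp\left(b_2\,\varepsilon^{-1}\log(\varepsilon^{-1})\right).$$
   Context: $\dim$ denotes Hausdorff dimension. An iterated function system (IFS) is a finite family $\{f_j\}_{j=1}^N$ of maps $f_j:\mathbb{R}^2\to\mathbb{R}^2$ of the form $f_j(x)=r_jA_jx+z_j$, where $r_j\in(0,1)$, $A_j\in O(2)$ is a rotation matrix and $z_j\in\mathbb{R}^2$. Its attractor is the unique nonempty compact set $C\subseteq\mathbb{R}^2$ with $C=\bigcup_{j=1}^N f_j(C)$. The IFS satisfies the open set condition if there is a nonempty open set $U\subseteq\mathbb{R}^2$ with $\bigcup_{j=1}^N f_j(U)\subseteq U$ and $f_i(U)\cap f_j(U)=\varnothing$ for all $i\neq j$. A Lipschitz graph is a set of the form $\Gamma=\{t\,\tau_1+g(t)\,\tau_2 : t\in A\}$, where $A\subseteq\mathbb{R}$, $g:A\to\mathbb{R}$ is Lipschitz, and $\tau_1=(\cos\theta,\sin\theta)$, $\tau_2=(-\sin\theta,\cos\theta)$ for some angle $\theta$; $\operatorname{Lip}(\Gamma)$ is the Lipschitz constant of $g$, i.e. $\inf\{\lambda : |g(s)-g(t)|\le\lambda|s-t| \text{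 for all } s,t\in A\}$. *)

theory Defs
  imports "HOL-Analysis.Analysis"
begin

(* The value of diam(U)^s entering a Hausdorff sum, with the usual conventions
   diam({})^s = 0 and diam(U)^0 = 1 for U nonempty (whereas 0 powr 0 = 0). *)
definition diam_pow :: "real \<Rightarrow> 'a::metric_space set \<Rightarrow> ennreal" where
  "diam_pow s U = (if U = {} then 0 else if s = 0 then 1 else ennreal (diameter U powr s))"

(* diameter is only meaningful on bounded sets, hence the explicit boundedness.
   Finite covers are included, since the U i may be empty. *)
definition hausdorff_pre_measure :: "real \<Rightarrow> real \<Rightarrow> 'a::metric_space set \<Rightarrow> ennreal" where
  "hausdorff_pre_measure s \<delta> E =
     Inf {(\<Sum>i. diam_pow s (U i)) | U :: nat \<Rightarrow> 'a set.
            E \<subseteq> (\<Union>i. U i) \<and> (\<forall>i. bounded (U i) \<and> diameter (U i) \<le> \<delta>)}"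

definition hausdorff_measure :: "real \<Rightarrow> 'a::metric_space set \<Rightarrow> ennreal" where
  "hausdorff_measure s E = (SUP \<delta>\<in>{0<..}. hausdorff_pre_measure s \<delta> E)"

(* Extended-real valued; the dimension of the empty set is 0. *)
definition hausdorff_dim :: "'a::metric_space set \<Rightarrow> ereal" where
  "hausdorff_dim E = Inf {ereal s | s. 0 \<le> s \<and> hausdorff_measure s E = 0}"

definition ifs :: "nat \<Rightarrow> (nat \<Rightarrow> real^2 \<Rightarrow> real^2) \<Rightarrow> bool" where
  "ifs N f \<longleftrightarrow> (\<forall>j\<in>{1..N}. \<exists>r A z. 0 < r \<and> r < 1 \<and> rotation_matrix A \<and>
     (\<forall>x. f j x = r *\<^sub>R (A *v x) + z))"

(* A nonempty compact invariant set of an IFS is unique, so this singles out the attractor. *)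
definition attractor :: "nat \<Rightarrow> (nat \<Rightarrow> real^2 \<Rightarrow> real^2) \<Rightarrow> (real^2) set \<Rightarrow> bool" where
  "attractor N f C \<longleftrightarrow> C \<noteq> {} \<and> compact C \<and> C = (\<Union>j\<in>{1..N}. f j ` C)"

definition open_set_condition :: "nat \<Rightarrow> (nat \<Rightarrow> real^2 \<Rightarrow> real^2) \<Rightarrow> bool" where
  "open_set_condition N f \<longleftrightarrow> (\<exists>U. U \<noteq> {} \<and> open U \<and> (\<Union>j\<in>{1..N}. f j ` U) \<subseteq> U \<and>
     (\<forall>i\<in>{1..N}. \<forall>j\<in>{1..N}. i \<noteq> j \<longrightarrow> f i ` U \<inter> f j ` U = {}))"

definition graph_over :: "real \<Rightarrow> real set \<Rightarrow> (real \<Rightarrow> real) \<Rightarrow> (real^2) set" where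
  "graph_over \<theta> A g =
     {t *\<^sub>R vector [cos \<theta>, sin \<theta>] + g t *\<^sub>R vector [- sin \<theta>, cos \<theta>] | t. t \<in> A}"

(* A Lipschitz graph together with its presentation (angle, domain, function), on which
   its Lipschitz constant depends. *)
definition lipschitz_graph :: "real \<Rightarrow> real set \<Rightarrow> (real \<Rightarrow> real) \<Rightarrow> (real^2) set \<Rightarrow> bool" where
  "lipschitz_graph \<theta> A g \<Gamma> \<longleftrightarrow> (\<exists>L. L-lipschitz_on A g) \<and> \<Gamma> = graph_over \<theta> A g"

(* lipschitz_on includes nonnegativity of the constant, which only matters when A has
   at most one point. *)
definition Lip :: "real set \<Rightarrow> (real \<Rightarrow> real) \<Rightarrow> real" where
  "Lip A g = Inf {L. L-lipschitz_on A g}"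

end

theory Submission
  imports Defs "HOL-Library.Sublist"
begin

text \<open>
  Let \<open>r j\<close> be the ratios of the system. Covering the attractor by cylinders shows that \<open>(\<Sum>j. r j) \<ge> 1\<close>, as the
  dimension is 1 (\<open>sum_ratios_ge_1\<close>), so \<open>(\<Sum>j. r j powr s) = 1\<close> for some \<open>s \<ge> 1\<close>.

  Consider words of length \<open>n\<close>. Rotations of the plane commute, so the linear part of the map of a word depends
  only on the multiset of its letters. There are at most \<open>(n + 1) ^ N\<close> multisets, hence some class \<open>T\<close> of words with a common
  ratio \<open>\<rho>\<close> and a common rotation has at least \<open>\<rho> powr (- s) / (n + 1) ^ N\<close> members (\<open>homothetic_words\<close>).
  The open set condition bounds the number of cylinders of \<open>T\<close> near a given one, and summing over dyadic shells bounds the sum of the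
  inverse distances from one cylinder to the others by a multiple of \<open>n * \<rho> powr (- s)\<close> (\<open>energy_bound\<close>).

  Two cylinders overlap in projection to a line for a proportion of directions comparable to \<open>\<rho>\<close> over their
  distance. By the energy bound there are few overlaps on average, and so the class contains families with separated
  projections whose size is \<open>1 / \<rho>\<close> up to a power of \<open>n\<close>; this holds on average over
  directions, for the logarithm of the size (\<open>average_log_packing_number\<close>).

  Iterating such a family gives a Cantor set in the attractor. The common rotation turns the direction of projection from one
  level to the next, so the family has to be chosen anew at each level, along the orbit of a direction under the rotation. A finite
  form of the maximal ergodic theorem together with compactness yields one direction for which the product of the sizes is large
  at all levels (\<open>good_orbit_exists\<close>). The Cantor set then projects injectively to a line with an inverse of Lipschitz constant
  \<open>1 / \<rho>\<close>, so it is a Lipschitz graph, and its dimension is at least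
  \<open>1 - \<epsilon>\<close> as soon as a multiple of \<open>ln n\<close> is at most \<open>\<epsilon> * n\<close> (\<open>lipschitz_graph_from_energy\<close>).
  This allows \<open>n\<close> to be of order \<open>inverse \<epsilon> * ln (inverse \<epsilon>)\<close>, and \<open>1 / \<rho>\<close> is at most exponential in \<open>n\<close>.
\<close>

section \<open>Separated projections\<close>

text \<open>In the applications \<open>t i\<close> is the coordinate of a point along a direction, so that the separation is required of
projections to a line.\<close>

definition separated :: "real \<Rightarrow> ('i \<Rightarrow> real) \<Rightarrow> 'i set \<Rightarrow> bool" where
  "separated \<eta> t V \<longleftrightarrow> (\<forall>i\<in>V. \<forall>j\<in>V. i \<noteq> j \<longrightarrow> \<eta> \<le> \<bar>t i - t j\<bar>)"

definition packing_number :: "real \<Rightarrow> ('i \<Rightarrow> real) \<Rightarrow> 'i set \<Rightarrow> nat" where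
  "packing_number \<eta> t T = Max (card ` {V. V \<subseteq> T \<and> separated \<eta> t V})"

lemma separated_subsets_finite: "finite T \<Longrightarrow> finite {V. V \<subseteq> T \<and> separated \<eta> t V}"
  by (rule finite_subset[of _ "Pow T"]) auto

lemma packing_number_ge:
  assumes "finite T" "V \<subseteq> T" "separated \<eta> t V"
  shows "card V \<le> packing_number \<eta> t T"
  unfolding packing_number_def using assms separated_subsets_finite[OF assms(1)]
  by (intro Max_ge) auto

lemma packing_number_witness:
  assumes "finite T"
  obtains V where "V \<subseteq> T" "separated \<eta> t V" "card V = packing_number \<eta> t T"
proof -
  have "packing_number \<eta> t T \<in> card ` {V. V \<subseteq> T \<and> separated \<eta> t V}"
    unfolding packing_number_def using separated_subsets_finite[OF assms]
    by (intro Max_in) (auto simp: separated_def)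
  then show ?thesis using that by auto
qed

lemma packing_number_le_card: "finite T \<Longrightarrow> packing_number \<eta> t T \<le> card T"
  by (metis packing_number_witness card_mono)

lemma packing_number_pos:
  assumes "finite T" "T \<noteq> {}"
  shows "1 \<le> packing_number \<eta> t T"
proof -
  obtain i where "i \<in> T" using assms by auto
  then show ?thesis using packing_number_ge[OF assms(1), of "{i}" \<eta> t] by (auto simp: separated_def)
qed

text \<open>Sort the points into bins of width \<open>\<eta>\<close>. By the Cauchy-Schwarz inequality few pairs in a common bin force
many occupied bins, and representatives of every other bin are separated.\<close>

lemma packing_number_close_pairs:
  fixes t :: "'i \<Rightarrow> real"
  assumes fin: "finite T" and \<eta>: "\<eta> > 0"
  shows "(real (card T))\<^sup>2 \<le> 2 * real (packing_number \<eta> t T) * real (card {(i,j) \<in> T \<times> T. \<bar>t i - t j\<bar> < \<eta>})"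
proof -
  define b where "b i = \<lfloor>t i / \<eta>\<rfloor>" for i
  define B where "B = b ` T"
  have finB: "finite B" using fin by (simp add: B_def)
  have "real (card T) = (\<Sum>k\<in>B. real (card {i\<in>T. b i = k}))"
    unfolding B_def using card_eq_sum sum.image_gen[OF fin, of "\<lambda>_. 1::real" b] by simp
  then have "(real (card T))\<^sup>2 \<le> (\<Sum>k\<in>B. (real (card {i\<in>T. b i = k}))\<^sup>2) * real (card B)"
    using sum_squared_le_sum_of_squares[of "\<lambda>k. real (card {i\<in>T. b i = k})" B] by simp
  also have "(\<Sum>k\<in>B. (real (card {i\<in>T. b i = k}))\<^sup>2) = real (card (\<Union>k\<in>B. {i\<in>T. b i = k} \<times> {i\<in>T. b i = k}))"
    using finB fin by (subst card_UN_disjoint) (auto simp: power2_eq_square card_cartesian_product)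
  also have "\<dots> \<le> real (card {(i,j) \<in> T \<times> T. \<bar>t i - t j\<bar> < \<eta>})"
  proof -
    have "\<bar>t i - t j\<bar> < \<eta>" if "b i = b j" for i j
    proof -
      have "\<bar>t i / \<eta> - t j / \<eta>\<bar> < 1" using that unfolding b_def by linarith
      then show ?thesis using \<eta> by (simp add: diff_divide_distrib[symmetric] divide_less_eq)
    qed
    then show ?thesis
      by (intro of_nat_mono card_mono finite_subset[OF _ finite_cartesian_product[OF fin fin]]) auto
  qed
  finally have 1: "(real (card T))\<^sup>2 \<le> real (card {(i,j) \<in> T \<times> T. \<bar>t i - t j\<bar> < \<eta>}) * real (card B)"
    by (simp add: mult_right_mono)
  have parity: "card {k\<in>B. P k} \<le> packing_number \<eta> t T"
    if P: "\<And>k l. P k \<Longrightarrow> P l \<Longrightarrow> even (k - l)" for P :: "int \<Rightarrow> bool"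
  proof -
    define g where "g k = (SOME i. i \<in> T \<and> b i = k)" for k
    have g: "g k \<in> T \<and> b (g k) = k" if "k \<in> B" for k
      
    proof -
      have "\<exists>i. i \<in> T \<and> b i = k" using that by (auto simp: B_def)
      then show ?thesis unfolding g_def by (rule someI_ex)
    qed
    have inj: "inj_on g {k\<in>B. P k}" by (rule inj_on_inverseI[of _ b]) (use g in auto)
    have "separated \<eta> t (g ` {k\<in>B. P k})"
      unfolding separated_def
    proof (intro ballI impI)
      fix i j assume "i \<in> g ` {k\<in>B. P k}" "j \<in> g ` {k\<in>B. P k}" "i \<noteq> j"
      then obtain k l where kl: "k \<in> B" "P k" "l \<in> B" "P l" "g k \<noteq> g l" "i = g k" "j = g l" by auto
      have "k \<noteq> l" "even (k - l)" using kl(5) P[OF kl(2,4)] by auto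
      then have "\<bar>k - l\<bar> \<ge> 2" by presburger
      then have "\<bar>b (g k) - b (g l)\<bar> \<ge> 2" using g[OF kl(1)] g[OF kl(3)] by simp
      then have "\<bar>t (g k) / \<eta> - t (g l) / \<eta>\<bar> \<ge> 1" unfolding b_def by linarith
      then show "\<eta> \<le> \<bar>t i - t j\<bar>"
        unfolding kl(6,7) using \<eta> by (simp add: diff_divide_distrib[symmetric] le_divide_eq)
    qed
    then have "card (g ` {k\<in>B. P k}) \<le> packing_number \<eta> t T"
      using g by (intro packing_number_ge[OF fin]) auto
    then show ?thesis using inj by (simp add: card_image)
  qed
  have "card B = card {k\<in>B. even k} + card {k\<in>B. odd k}"
    using finB by (subst card_Un_disjoint[symmetric]) (auto intro: arg_cong[where f=card])
  also have "\<dots> \<le> 2 * packing_number \<eta> t T"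
    using parity[of even] parity[of odd] by auto
  finally have "real (card B) \<le> 2 * real (packing_number \<eta> t T)" by linarith
  then have "real (card {(i,j) \<in> T \<times> T. \<bar>t i - t j\<bar> < \<eta>}) * real (card B)
     \<le> real (card {(i,j) \<in> T \<times> T. \<bar>t i - t j\<bar> < \<eta>}) * (2 * real (packing_number \<eta> t T))"
    by (intro mult_left_mono) auto
  with 1 show ?thesis by (simp add: mult_ac)
qed

text \<open>Equally spaced slopes serve as a finite sample of directions. The vectors are not normalised, which costs only a
bounded factor and avoids trigonometry.\<close>

definition slope_dir :: "nat \<Rightarrow> nat \<Rightarrow> real^2" where
  "slope_dir L l = vector [1, real l / real L]"

lemma inner_real2: "(x::real^2) \<bullet> y = x$1 * y$1 + x$2 * y$2"
  by (simp add: inner_vec_def sum_2)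

lemma norm_real2: "norm (x::real^2) \<le> \<bar>x$1\<bar> + \<bar>x$2\<bar>"
  using norm_le_l1_cart[of x] by (simp add: sum_2)

lemma slope_dir_norm:
  assumes "l < L" shows "1 \<le> norm (slope_dir L l)" "norm (slope_dir L l) \<le> 2"
proof -
  show "1 \<le> norm (slope_dir L l)"
    using component_le_norm_cart[of "slope_dir L l" 1] by (simp add: slope_dir_def)
  show "norm (slope_dir L l) \<le> 2"
    using norm_real2[of "slope_dir L l"] assms by (simp add: slope_dir_def divide_le_eq_1 order_trans)
qed

lemma card_nats_in_interval:
  fixes x y :: real
  assumes "x \<le> y"
  shows "real (card {l::nat. x < real l \<and> real l < y}) \<le> y - x + 1"
proof -
  have "card {l::nat. x < real l \<and> real l < y} = card (int ` {l::nat. x < real l \<and> real l < y})"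
    by (simp add: card_image inj_on_def)
  also have "\<dots> \<le> card {\<lfloor>x\<rfloor>+1..\<lceil>y\<rceil>-1}"
    by (intro card_mono) (auto, linarith+)
  also have "\<dots> = nat (\<lceil>y\<rceil> - 1 - \<lfloor>x\<rfloor>)" by simp
  finally have "real (card {l::nat. x < real l \<and> real l < y}) \<le> real (nat (\<lceil>y\<rceil> - 1 - \<lfloor>x\<rfloor>))" by linarith
  also have "\<dots> \<le> y - x + 1" using assms by linarith
  finally show ?thesis .
qed

text \<open>As a function of the slope the inner product with \<open>v\<close> is affine. If its leading coefficient is small compared with \<open>v\<close>,
the values are never small unless \<open>v\<close> itself is; otherwise the slopes with a small value fill an interval of length
comparable to \<open>\<eta> / norm v\<close>. The summand \<open>D * \<mu>\<close> absorbs the rounding error in counting slopes.\<close>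

lemma few_slopes_annihilate:
  fixes v :: "real^2"
  assumes L: "L > 0" "1 \<le> \<mu> * real L" and \<eta>: "\<eta> > 0" and v: "v \<noteq> 0" "norm v \<le> D" and mu: "\<mu> > 0"
  shows "real (card {l. l < L \<and> \<bar>slope_dir L l \<bullet> v\<bar> < \<eta>}) \<le> real L * (6 * \<eta> + D * \<mu>) / norm v"
proof -
  let ?S = "{l. l < L \<and> \<bar>slope_dir L l \<bullet> v\<bar> < \<eta>}"
  have nv: "norm v > 0" using v by simp
  have D: "D > 0" using v nv by linarith
  have e: "slope_dir L l \<bullet> v = v$1 + real l / real L * v$2" for l
    by (simp add: inner_real2 slope_dir_def)
  show ?thesis
  proof (cases "\<bar>v$2\<bar> \<le> \<bar>v$1\<bar> / 2")
    case True
    show ?thesis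
    proof (cases "?S = {}")
      case True
      show ?thesis unfolding True using D \<eta> mu by simp
    next
      case False
      then obtain l where l: "l < L" "\<bar>v$1 + real l / real L * v$2\<bar> < \<eta>" by (auto simp: e)
      have "\<bar>real l / real L * v$2\<bar> \<le> 1 * \<bar>v$2\<bar>"
        unfolding abs_mult using l L by (intro mult_right_mono) auto
      then have "\<bar>v$1\<bar> < 2 * \<eta>" using l True by linarith
      then have "norm v \<le> 6 * \<eta>" using norm_real2[of v] True \<eta> by linarith
      then have "1 \<le> (6 * \<eta> + D * \<mu>) / norm v" using nv D mu by (simp add: le_divide_eq add_increasing2)
      then have "real L * 1 \<le> real L * ((6 * \<eta> + D * \<mu>) / norm v)" by (intro mult_left_mono) auto
      moreover have "card ?S \<le> card {..<L}" by (intro card_mono) auto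
      ultimately show ?thesis by simp
    qed
  next
    case False
    then have v2: "norm v \<le> 3 * \<bar>v$2\<bar>" "\<bar>v$2\<bar> > 0" using norm_real2[of v] by linarith+
    define m where "m = - v$1 * real L / v$2"
    define d where "d = \<eta> * real L / \<bar>v$2\<bar>"
    have "?S \<subseteq> {l. m - d < real l \<and> real l < m + d}"
    proof clarify
      fix l assume "\<bar>slope_dir L l \<bullet> v\<bar> < \<eta>"
      moreover have "slope_dir L l \<bullet> v = (real l - m) * (v$2 / real L)"
        using L v2 by (simp add: e m_def field_simps)
      ultimately have "\<bar>real l - m\<bar> * (\<bar>v$2\<bar> / real L) < \<eta>" by (simp add: abs_mult)
      then have "\<bar>real l - m\<bar> < d" using L v2 by (simp add: d_def field_simps)
      then show "m - d < real l \<and> real l < m + d" by linarith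
    qed
    moreover have "finite {l::nat. m - d < real l \<and> real l < m + d}"
      by (rule finite_subset[of _ "{..nat \<lceil>m+d\<rceil>}"]) (auto, linarith)
    ultimately have "card ?S \<le> card {l::nat. m - d < real l \<and> real l < m + d}" by (intro card_mono)
    moreover have "d \<ge> 0" using \<eta> by (simp add: d_def)
    ultimately have "real (card ?S) \<le> 2 * d + 1" using card_nats_in_interval[of "m - d" "m + d"] by linarith
    also have "d \<le> 3 * \<eta> * real L / norm v"
    proof -
      have "1 / \<bar>v$2\<bar> \<le> 3 / norm v" using v2 nv by (simp add: field_simps)
      then have "(\<eta> * real L) * (1 / \<bar>v$2\<bar>) \<le> (\<eta> * real L) * (3 / norm v)" using \<eta> by (intro mult_left_mono) auto
      then show ?thesis by (simp add: d_def mult_ac)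
    qed
    also have "1 \<le> D / norm v * (\<mu> * real L)"
      using mult_mono[of 1 "D / norm v" 1 "\<mu> * real L"] v nv L D by (simp add: divide_nonneg_pos)
    finally show ?thesis by (simp add: add_divide_distrib algebra_simps)
  qed
qed

lemma orthogonal_matrix_inner:
  fixes Q :: "real^'n^'n"
  shows "(Q *v x) \<bullet> y = x \<bullet> (transpose Q *v y)"
  by (metis dot_lmul_matrix vector_transpose_matrix inner_commute transpose_transpose)

lemma norm_orthogonal_transpose:
  fixes Q :: "real^'n^'n"
  assumes "orthogonal_matrix Q"
  shows "norm (transpose Q *v x) = norm x"
proof -
  have "Q *v (transpose Q *v x) = x"
    using assms by (metis matrix_vector_mul_assoc orthogonal_matrix_def matrix_vector_mul_lid)
  then have "(transpose Q *v x) \<bullet> (transpose Q *v x) = x \<bullet> x"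
    using orthogonal_matrix_inner[of "transpose Q" x "transpose Q *v x"] by simp
  then show ?thesis by (simp add: norm_eq)
qed

text \<open>A pair of points is close in projection for a proportion of directions inversely proportional to its distance, so the
energy bound \<open>E\<close> controls the number of close pairs on average over the directions. The bound on packing numbers is then
averaged with \<open>ln x \<le> x - 1\<close>, which is Jensen's inequality for the logarithm. The matrix \<open>Q\<close> is harmless because
only distances enter.\<close>

lemma average_log_packing_number:
  fixes z :: "'i \<Rightarrow> real^2"
  assumes fin: "finite T" "T \<noteq> {}" and \<eta>: "\<eta> > 0" and L: "L > 0" "1 \<le> \<mu> * real L" "\<mu> > 0"
    and z: "\<And>i j. i \<in> T \<Longrightarrow> j \<in> T \<Longrightarrow> i \<noteq> j \<Longrightarrow> z i \<noteq> z j \<and> norm (z i - z j) \<le> D"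
    and Q: "orthogonal_matrix Q"
    and E: "\<And>i. i \<in> T \<Longrightarrow> (\<Sum>j\<in>T - {i}. 1 / norm (z i - z j)) \<le> E" and D: "D \<ge> 0"
  shows "real L * ln (real (card T) / (2 * (1 + (6 * \<eta> + D * \<mu>) * E)))
    \<le> (\<Sum>l<L. ln (real (packing_number \<eta> (\<lambda>i. (Q *v slope_dir L l) \<bullet> z i) T)))"
proof -
  define t where "t l i = (Q *v slope_dir L l) \<bullet> z i" for l i
  define P where "P l = real (card {(i,j) \<in> T \<times> T. \<bar>t l i - t l j\<bar> < \<eta>})" for l
  define M where "M = real (card T)"
  define K where "K = 6 * \<eta> + D * \<mu>"
  define a where "a = M * (1 + K * E)"
  have M: "M \<ge> 1" using fin by (simp add: M_def Suc_le_eq card_gt_0_iff)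
  have K: "K > 0" using \<eta> D L by (simp add: K_def add_pos_nonneg)
  obtain i0 where "i0 \<in> T" using fin by auto
  then have "E \<ge> 0" using E[of i0] by (smt (verit) sum_nonneg divide_nonneg_nonneg norm_ge_zero)
  then have a: "a > 0" using M K by (simp add: a_def add_pos_nonneg)
  have Ppos: "P l > 0" for l
  proof -
    have "(i0,i0) \<in> {(i,j) \<in> T \<times> T. \<bar>t l i - t l j\<bar> < \<eta>}" using \<open>i0 \<in> T\<close> \<eta> by auto
    moreover have "finite {(i,j) \<in> T \<times> T. \<bar>t l i - t l j\<bar> < \<eta>}"
      by (rule finite_subset[OF _ finite_cartesian_product[OF fin(1) fin(1)]]) auto
    ultimately show ?thesis unfolding P_def of_nat_0_less_iff card_gt_0_iff by blast
  qed
  have Psum: "P l = (\<Sum>i\<in>T. \<Sum>j\<in>T. of_bool (\<bar>t l i - t l j\<bar> < \<eta>))" for l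
  proof -
    have "P l = (\<Sum>p\<in>T \<times> T. of_bool (\<bar>t l (fst p) - t l (snd p)\<bar> < \<eta>))"
      unfolding P_def using fin
      by (subst sum_of_bool_eq) (auto intro!: arg_cong[where f=card] arg_cong[where f=real] simp: case_prod_unfold)
    then show ?thesis by (simp add: sum.cartesian_product case_prod_unfold)
  qed
  have pair: "(\<Sum>l<L. of_bool (\<bar>t l i - t l j\<bar> < \<eta>)) \<le> real L * K / norm (z i - z j)"
    if "i \<in> T" "j \<in> T" "i \<noteq> j" for i j
  proof -
    let ?v = "transpose Q *v (z i - z j)"
    have n: "norm ?v = norm (z i - z j)"
      using Q by (rule norm_orthogonal_transpose)
    have "(\<Sum>l<L. of_bool (\<bar>t l i - t l j\<bar> < \<eta>)) = real (card {l. l < L \<and> \<bar>slope_dir L l \<bullet> ?v\<bar> < \<eta>})"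
      by (subst sum_of_bool_eq) (auto intro!: arg_cong[where f=card]
           simp: t_def orthogonal_matrix_inner inner_diff_right matrix_vector_mult_diff_distrib)
    also have "\<dots> \<le> real L * (6 * \<eta> + D * \<mu>) / norm ?v"
    proof (rule few_slopes_annihilate[OF L(1,2) \<eta> _ _ L(3)])
      show "?v \<noteq> 0" using z[OF that] n by (metis norm_eq_zero right_minus_eq)
      show "norm ?v \<le> D" using z[OF that] n by simp
    qed
    finally show ?thesis by (simp only: n K_def)
  qed
  have "(\<Sum>l<L. P l) = (\<Sum>i\<in>T. \<Sum>j\<in>T. \<Sum>l<L. of_bool (\<bar>t l i - t l j\<bar> < \<eta>))"
    unfolding Psum by (subst sum.swap, intro sum.cong refl, subst sum.swap, rule refl)
  also have "\<dots> \<le> (\<Sum>i\<in>T. real L * (1 + K * E))"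
  proof (intro sum_mono)
    fix i assume i: "i \<in> T"
    have "(\<Sum>j\<in>T. \<Sum>l<L. of_bool (\<bar>t l i - t l j\<bar> < \<eta>))
        = real L + (\<Sum>j\<in>T - {i}. \<Sum>l<L. of_bool (\<bar>t l i - t l j\<bar> < \<eta>))"
      using i fin \<eta> by (subst sum.remove[of T i]) auto
    also have "(\<Sum>j\<in>T - {i}. \<Sum>l<L. of_bool (\<bar>t l i - t l j\<bar> < \<eta>)) \<le> (\<Sum>j\<in>T - {i}. real L * K / norm (z i - z j))"
      using i by (intro sum_mono pair) auto
    also have "\<dots> = real L * K * (\<Sum>j\<in>T - {i}. 1 / norm (z i - z j))" by (simp add: sum_distrib_left)
    also have "\<dots> \<le> real L * K * E" using E[OF i] K by (intro mult_left_mono) auto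
    finally show "(\<Sum>j\<in>T. \<Sum>l<L. of_bool (\<bar>t l i - t l j\<bar> < \<eta>)) \<le> real L * (1 + K * E)"
      by (simp add: algebra_simps)
  qed
  also have "\<dots> = real L * a" by (simp add: a_def M_def)
  finally have Pavg: "(\<Sum>l<L. P l) \<le> real L * a" .
  \<comment> \<open>Jensen's inequality at the mean \<open>a\<close> of the numbers \<open>P l\<close> of close pairs\<close>
  have each: "ln (M / (2 * (1 + K * E))) + 1 - P l / a \<le> ln (real (packing_number \<eta> (t l) T))" for l
  proof -
    have "M\<^sup>2 / (2 * P l) \<le> real (packing_number \<eta> (t l) T)"
      using packing_number_close_pairs[OF fin(1) \<eta>, of "t l"] Ppos[of l]
      by (simp add: M_def P_def divide_le_eq mult_ac)
    then have "ln (M\<^sup>2 / (2 * P l)) \<le> ln (real (packing_number \<eta> (t l) T))"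
      using M Ppos[of l] by (intro ln_mono) auto
    moreover have "ln (M\<^sup>2 / (2 * P l)) = ln (M / (2 * (1 + K * E))) - ln (P l / a)"
    proof -
      have q: "1 + K * E > 0" using \<open>E \<ge> 0\<close> K by (simp add: add_pos_nonneg)
      have "M\<^sup>2 / (2 * P l) = (M / (2 * q)) / (P l / (M * q))" if "q > 0" for q
        using that M by (simp add: power2_eq_square)
      then have "M\<^sup>2 / (2 * P l) = (M / (2 * (1 + K * E))) / (P l / a)"
        using q by (simp only: a_def)
      moreover have "M / (2 * (1 + K * E)) > 0" "P l / a > 0" using q M a Ppos[of l] by (simp_all only: divide_pos_pos zero_less_mult_iff) auto
      ultimately show ?thesis by (simp only: ln_divide_pos)
    qed
    moreover have "ln (P l / a) \<le> P l / a - 1" using a Ppos[of l] by (intro ln_le_minus_one) auto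
    ultimately show ?thesis by linarith
  qed
  have "real L * ln (M / (2 * (1 + K * E))) \<le> real L * ln (M / (2 * (1 + K * E))) + (real L - (\<Sum>l<L. P l) / a)"
    using Pavg a by (simp add: divide_le_eq)
  also have "\<dots> = (\<Sum>l<L. ln (M / (2 * (1 + K * E))) + 1 - P l / a)"
    by (simp add: sum.distrib sum_subtractf sum_divide_distrib algebra_simps)
  also have "\<dots> \<le> (\<Sum>l<L. ln (real (packing_number \<eta> (t l) T)))" by (intro sum_mono each)
  finally have "real L * ln (M / (2 * (1 + K * E))) \<le> (\<Sum>l<L. ln (real (packing_number \<eta> (t l) T)))" .
  moreover have "t = (\<lambda>l i. (Q *v slope_dir L l) \<bullet> z i)" by (intro ext) (rule t_def)
  ultimately show ?thesis by (simp only: M_def K_def)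
qed

text \<open>A family that fails to be separated violates a strict inequality, and goes on to do so in nearby directions.\<close>

lemma packing_number_upper_semicontinuous:
  fixes z :: "'i \<Rightarrow> 'a::euclidean_space"
  assumes fin: "finite T"
  shows "eventually (\<lambda>e'. packing_number \<eta> (\<lambda>i. e' \<bullet> z i) T \<le> packing_number \<eta> (\<lambda>i. e \<bullet> z i) T) (nhds e)"
proof -
  have "eventually (\<lambda>e'. separated \<eta> (\<lambda>i. e' \<bullet> z i) V \<longrightarrow> separated \<eta> (\<lambda>i. e \<bullet> z i) V) (nhds e)" for V
  proof (cases "separated \<eta> (\<lambda>i. e \<bullet> z i) V")
    case False
    then obtain i j where ij: "i \<in> V" "j \<in> V" "i \<noteq> j" "\<bar>e \<bullet> z i - e \<bullet> z j\<bar> < \<eta>"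
      by (auto simp: separated_def not_le)
    have "((\<lambda>e'. \<bar>e' \<bullet> z i - e' \<bullet> z j\<bar>) \<longlongrightarrow> \<bar>e \<bullet> z i - e \<bullet> z j\<bar>) (nhds e)"
      by (intro tendsto_intros filterlim_ident)
    then have "eventually (\<lambda>e'. \<bar>e' \<bullet> z i - e' \<bullet> z j\<bar> < \<eta>) (nhds e)"
      using ij(4) by (rule order_tendstoD)
    then show ?thesis
      by eventually_elim (use ij in \<open>auto simp: separated_def not_le[symmetric]\<close>)
  qed auto
  then have "eventually (\<lambda>e'. \<forall>V\<in>Pow T. separated \<eta> (\<lambda>i. e' \<bullet> z i) V \<longrightarrow> separated \<eta> (\<lambda>i. e \<bullet> z i) V) (nhds e)"
    using fin by (intro eventually_ball_finite) auto
  then show ?thesis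
  proof eventually_elim
    case (elim e')
    obtain V where "V \<subseteq> T" "separated \<eta> (\<lambda>i. e' \<bullet> z i) V" "card V = packing_number \<eta> (\<lambda>i. e' \<bullet> z i) T"
      using packing_number_witness[OF fin] .
    with elim show ?case using packing_number_ge[OF fin, of V \<eta> "\<lambda>i. e \<bullet> z i"] by auto
  qed
qed

section \<open>Words and their similarity maps\<close>

abbreviation words :: "'j set \<Rightarrow> nat \<Rightarrow> 'j list set" where
  "words J n \<equiv> {w. set w \<subseteq> J \<and> length w = n}"

abbreviation weight :: "('j \<Rightarrow> real) \<Rightarrow> 'j list \<Rightarrow> real" where
  "weight p w \<equiv> prod_list (map p w)"

lemma finite_words: "finite J \<Longrightarrow> finite (words J n)"
  by (rule finite_lists_length_eq)

lemma sum_weight_words: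
  assumes "finite J"
  shows "(\<Sum>w\<in>words J n. weight p w) = (\<Sum>j\<in>J. p j) ^ n"
proof (induction n)
  case 0
  have "words J 0 = {[]}" by auto
  then show ?case by simp
next
  case (Suc n)
  have inj: "inj_on (\<lambda>(xs, j). j # xs) (words J n \<times> J)" by (auto simp: inj_on_def)
  have "(\<Sum>w\<in>words J (Suc n). weight p w) = (\<Sum>x\<in>words J n \<times> J. p (snd x) * weight p (fst x))"
    unfolding lists_length_Suc_eq by (subst sum.reindex[OF inj]) (auto intro!: sum.cong)
  also have "\<dots> = (\<Sum>w\<in>words J n. weight p w) * (\<Sum>j\<in>J. p j)"
    unfolding sum_product sum.cartesian_product by (auto intro!: sum.cong)
  finally show ?case using Suc.IH by simp
qed

lemma weight_pos: "(\<And>j. j \<in> J \<Longrightarrow> 0 < p j) \<Longrightarrow> set w \<subseteq> J \<Longrightarrow> 0 < weight p w"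
  by (induction w) auto

lemma weight_le_power:
  assumes "\<And>j. j \<in> J \<Longrightarrow> 0 < p j \<and> p j \<le> b" "set w \<subseteq> J"
  shows "weight p w \<le> b ^ length w"
  using assms(2)
proof (induction w)
  case (Cons j w)
  have "0 < weight p w" using assms(1) Cons.prems by (intro weight_pos[of J]) auto
  moreover have "0 < p j" "p j \<le> b" using assms(1)[of j] Cons.prems by auto
  ultimately show ?case using Cons by (auto intro!: mult_mono)
qed simp

lemma weight_ge_power:
  assumes "\<And>j. j \<in> J \<Longrightarrow> b \<le> p j" "0 \<le> b" "set w \<subseteq> J"
  shows "b ^ length w \<le> weight p w"
  using assms(3)
proof (induction w)
  case (Cons j w)
  then have "b \<le> p j" "b ^ length w \<le> weight p w" using assms(1) by auto
  then show ?case using assms(2) by (auto intro!: mult_mono)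
qed simp

lemma weight_powr:
  assumes "\<And>j. j \<in> J \<Longrightarrow> 0 < p j" "set w \<subseteq> J"
  shows "weight (\<lambda>j. p j powr s) w = weight p w powr s"
  using assms(2)
proof (induction w)
  case (Cons j w)
  then show ?case using assms(1) weight_pos[of J p w] by (simp add: powr_mult less_imp_le)
qed simp

text \<open>There are only polynomially many multisets of letters, so one of them carries at least a polynomially small
share of the total mass 1.\<close>

lemma heavy_letter_class:
  fixes p :: "'j \<Rightarrow> real"
  assumes J: "finite J" and p: "(\<Sum>j\<in>J. p j) = 1"
  obtains M where "1 / real ((n + 1) ^ card J) \<le> (\<Sum>w\<in>{w \<in> words J n. mset w = M}. weight p w)"
proof -
  let ?W = "words J n"
  have fin: "finite ?W" using J by (rule finite_words)
  have "card (mset ` ?W) \<le> (n + 1) ^ card J"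
  proof -
    let ?g = "\<lambda>M. restrict (count M) J"
    have "inj_on ?g (mset ` ?W)"
    proof (rule inj_onI)
      fix M M' assume M: "M \<in> mset ` ?W" "M' \<in> mset ` ?W" and eq: "?g M = ?g M'"
      show "M = M'"
      proof (rule multiset_eqI)
        fix j
        show "count M j = count M' j"
        proof (cases "j \<in> J")
          case True
          then show ?thesis using fun_cong[OF eq, of j] by simp
        next
          case False
          then have "j \<notin># M" "j \<notin># M'" using M by auto
          then show ?thesis by (simp add: not_in_iff)
        qed
      qed
    qed
    moreover have "?g ` (mset ` ?W) \<subseteq> PiE J (\<lambda>_. {0..n})"
      by (auto simp: count_le_size[of "mset _", simplified size_mset])
    moreover have "finite (PiE J (\<lambda>_. {0..n}))" using J by (intro finite_PiE) auto
    ultimately have "card (mset ` ?W) \<le> card (PiE J (\<lambda>_. {0..n}))" by (rule card_inj_on_le)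
    then show ?thesis using J by (simp add: card_PiE)
  qed
  then have types: "real (card (mset ` ?W)) \<le> real ((n + 1) ^ card J)" by linarith
  have total: "(\<Sum>M\<in>mset ` ?W. \<Sum>w\<in>{w \<in> ?W. mset w = M}. weight p w) = 1"
    using sum.image_gen[OF fin, of "weight p" mset] sum_weight_words[OF J, of p n] p by simp
  have "\<exists>M. 1 / real ((n + 1) ^ card J) \<le> (\<Sum>w\<in>{w \<in> ?W. mset w = M}. weight p w)"
  proof (rule ccontr)
    assume *: "\<nexists>M. 1 / real ((n + 1) ^ card J) \<le> (\<Sum>w\<in>{w \<in> ?W. mset w = M}. weight p w)"
    have "mset ` ?W \<noteq> {}"
    proof
      assume "mset ` ?W = {}"
      then show False using total by (simp only: sum.empty zero_neq_one)
    qed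
    then have "(\<Sum>M\<in>mset ` ?W. \<Sum>w\<in>{w \<in> ?W. mset w = M}. weight p w)
        < (\<Sum>M\<in>mset ` ?W. 1 / real ((n + 1) ^ card J))"
      using * fin by (intro sum_strict_mono) (auto simp: not_le)
    also have "\<dots> = real (card (mset ` ?W)) / real ((n + 1) ^ card J)" by simp
    also have "\<dots> \<le> 1" using types by (simp add: divide_le_eq_1)
    finally show False using total by linarith
  qed
  then show ?thesis using that by blast
qed

text \<open>The squares of the two differences sum to the squared column norms minus twice the determinant, that is to \<open>1 + 1 - 2\<close>.\<close>

lemma rotation_matrix_2_form:
  fixes A :: "real^2^2"
  assumes "rotation_matrix A"
  shows "A$2$2 = A$1$1" "A$1$2 = - A$2$1"
proof -
  have "transpose A ** A = mat 1" and det: "det A = 1"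
    using assms by (auto simp: rotation_matrix_def orthogonal_matrix_def)
  then have "(transpose A ** A) $ 1 $ 1 = 1" "(transpose A ** A) $ 2 $ 2 = 1" by (auto simp: mat_def)
  then have "A$1$1 * A$1$1 + A$2$1 * A$2$1 = 1" "A$1$2 * A$1$2 + A$2$2 * A$2$2 = 1"
    by (simp_all add: matrix_matrix_mult_def transpose_def sum_2)
  then have "(A$1$1 - A$2$2)\<^sup>2 + (A$1$2 + A$2$1)\<^sup>2 = 0"
    using det by (simp add: det_2 power2_eq_square algebra_simps)
  then have "A$1$1 - A$2$2 = 0 \<and> A$1$2 + A$2$1 = 0" by (simp only: sum_power2_eq_zero_iff)
  then show "A$2$2 = A$1$1" "A$1$2 = - A$2$1" by linarith+
qed

lemma rotation_matrix_2_commute: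
  fixes A B :: "real^2^2"
  assumes "rotation_matrix A" "rotation_matrix B"
  shows "A ** B = B ** A"
  using rotation_matrix_2_form[OF assms(1)] rotation_matrix_2_form[OF assms(2)]
  by (simp add: vec_eq_iff forall_2 matrix_matrix_mult_def sum_2 algebra_simps)

lemma rotation_matrix_mult:
  fixes A B :: "real^'n^'n"
  shows "rotation_matrix A \<Longrightarrow> rotation_matrix B \<Longrightarrow> rotation_matrix (A ** B)"
  unfolding rotation_matrix_def using orthogonal_matrix_mul[of A B] by (simp add: det_mul)

lemma rotation_matrix_norm:
  fixes A :: "real^'n^'n"
  assumes "rotation_matrix A" shows "norm (A *v x) = norm x"
  using norm_orthogonal_transpose[of "transpose A" x] assms
  by (simp add: rotation_matrix_def orthogonal_matrix_transpose)

locale similarity_system =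
  fixes J :: "nat set" and f :: "nat \<Rightarrow> real^2 \<Rightarrow> real^2" and r :: "nat \<Rightarrow> real" and A :: "nat \<Rightarrow> real^2^2"
  assumes finite_J: "finite J"
    and ratio: "j \<in> J \<Longrightarrow> 0 < r j \<and> r j < 1"
    and rotation: "j \<in> J \<Longrightarrow> rotation_matrix (A j)"
    and similarity: "j \<in> J \<Longrightarrow> f j x - f j y = r j *\<^sub>R (A j *v (x - y))"
begin

definition rot :: "nat list \<Rightarrow> real^2^2" where
  "rot w = foldr (\<lambda>j B. A j ** B) w (mat 1)"

lemma rotation_rot: "set w \<subseteq> J \<Longrightarrow> rotation_matrix (rot w)"
proof (induction w)
  case Nil
  then show ?case by (simp add: rot_def rotation_matrix_def orthogonal_matrix_id)
next
  case (Cons j w)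
  then show ?case using rotation by (simp add: rot_def rotation_matrix_mult)
qed

text \<open>This is where the plane enters: its rotations commute.\<close>

lemma rot_depends_on_letters:
  assumes "mset w = mset v" "set w \<subseteq> J"
  shows "rot w = rot v"
proof -
  have "fold (\<lambda>j (B::real^2^2). A j ** B) (rev w) = fold (\<lambda>j B. A j ** B) (rev v)"
  proof (rule fold_multiset_equiv)
    fix i j assume "i \<in> set (rev w)" "j \<in> set (rev w)"
    then have "A i ** A j = A j ** A i" using assms(2) rotation by (intro rotation_matrix_2_commute) auto
    then show "(\<lambda>B. A i ** B) \<circ> (\<lambda>B. A j ** B) = (\<lambda>B. A j ** B) \<circ> (\<lambda>B. A i ** B)"
      by (simp add: fun_eq_iff matrix_mul_assoc)
  qed (use assms in simp)
  then show ?thesis by (simp only: rot_def foldr_conv_fold)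
qed

lemma word_similarity:
  "set w \<subseteq> J \<Longrightarrow> foldr f w x - foldr f w y = weight r w *\<^sub>R (rot w *v (x - y))"
proof (induction w)
  case Nil
  then show ?case by (simp add: rot_def)
next
  case (Cons j w)
  then have "foldr f (j # w) x - foldr f (j # w) y = r j *\<^sub>R (A j *v (weight r w *\<^sub>R (rot w *v (x - y))))"
    using similarity[of j "foldr f w x" "foldr f w y"] by simp
  also have "\<dots> = (r j * weight r w) *\<^sub>R (A j *v (rot w *v (x - y)))"
    by (simp add: matrix_vector_mult_scaleR)
  also have "A j *v (rot w *v (x - y)) = rot (j # w) *v (x - y)"
    by (simp add: rot_def matrix_vector_mul_assoc)
  finally show ?case by simp
qed

lemma word_dist: "set w \<subseteq> J \<Longrightarrow> dist (foldr f w x) (foldr f w y) = weight r w * dist x y"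
  using weight_pos[of J r w] ratio rotation_matrix_norm[OF rotation_rot]
  by (simp add: dist_norm word_similarity)

lemma weight_r_pos: "set w \<subseteq> J \<Longrightarrow> 0 < weight r w"
  by (rule weight_pos) (use ratio in auto)

lemma word_invariant: "(\<And>j. j \<in> J \<Longrightarrow> f j ` X \<subseteq> X) \<Longrightarrow> set w \<subseteq> J \<Longrightarrow> x \<in> X \<Longrightarrow> foldr f w x \<in> X"
  by (induction w) auto

lemma inj_word: "set w \<subseteq> J \<Longrightarrow> foldr f w x = foldr f w y \<Longrightarrow> x = y"
  using word_dist[of w x y] weight_r_pos[of w] by simp

lemma word_ball:
  assumes w: "set w \<subseteq> J" and y: "dist (foldr f w x) y < weight r w * c"
  obtains x' where "y = foldr f w x'" "dist x x' < c"
proof -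
  define k where "k = weight r w"
  have k: "k > 0" unfolding k_def using w by (rule weight_r_pos)
  have R: "rotation_matrix (rot w)" using w by (rule rotation_rot)
  define x' where "x' = x + (1 / k) *\<^sub>R (transpose (rot w) *v (y - foldr f w x))"
  have "rot w *v (x' - x) = (1 / k) *\<^sub>R (rot w *v (transpose (rot w) *v (y - foldr f w x)))"
    by (simp add: x'_def matrix_vector_mult_scaleR)
  also have "rot w *v (transpose (rot w) *v (y - foldr f w x)) = y - foldr f w x"
    using R by (metis rotation_matrix_def orthogonal_matrix_def matrix_vector_mul_assoc matrix_vector_mul_lid)
  finally have "foldr f w x' - foldr f w x = y - foldr f w x"
    using word_similarity[OF w, of x' x] k by (simp add: k_def)
  then have yx: "y = foldr f w x'" by simp
  moreover have "dist x x' < c" using y word_dist[OF w, of x x'] k unfolding yx k_def by simp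
  ultimately show ?thesis by (rule that)
qed

end

text \<open>Compare areas.\<close>

lemma card_disjoint_balls:
  fixes x :: "'i \<Rightarrow> real^2"
  assumes fin: "finite I" and disj: "\<And>i j. i \<in> I \<Longrightarrow> j \<in> I \<Longrightarrow> i \<noteq> j \<Longrightarrow> ball (x i) \<eta> \<inter> ball (x j) \<eta> = {}"
    and near: "\<And>i. i \<in> I \<Longrightarrow> dist y (x i) \<le> T" and \<eta>: "\<eta> > 0" and T: "T \<ge> 0"
  shows "real (card I) * \<eta>\<^sup>2 \<le> (T + \<eta>)\<^sup>2"
proof -
  define V where "V = unit_ball_vol 2"
  have V: "V > 0" by (simp add: V_def)
  have ball: "measure lborel (ball z s) = V * s\<^sup>2" if "s \<ge> 0" for z :: "real^2" and s
    using content_ball[OF that, of z] by (simp add: V_def)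
  have "real (card I) * (V * \<eta>\<^sup>2) = (\<Sum>i\<in>I. measure lborel (ball (x i) \<eta>))"
    using \<eta> by (simp add: ball)
  also have "\<dots> = measure lborel (\<Union>i\<in>I. ball (x i) \<eta>)"
    using fin disj by (intro measure_finite_Union[symmetric])
      (auto simp: disjoint_family_on_def less_imp_neq[OF emeasure_bounded_finite[OF bounded_ball], simplified])
  also have "\<dots> \<le> measure lborel (ball y (T + \<eta>))"
  proof (rule measure_mono_fmeasurable)
    show "(\<Union>i\<in>I. ball (x i) \<eta>) \<subseteq> ball y (T + \<eta>)"
    proof
      fix u assume "u \<in> (\<Union>i\<in>I. ball (x i) \<eta>)"
      then obtain i where "i \<in> I" "dist (x i) u < \<eta>" by auto
      then show "u \<in> ball y (T + \<eta>)" using near[of i] dist_triangle[of y u "x i"] by simp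
    qed
    show "ball y (T + \<eta>) \<in> fmeasurable lborel"
      by (rule fmeasurableI) (use emeasure_lborel_ball_finite in auto)
    show "(\<Union>i\<in>I. ball (x i) \<eta>) \<in> sets lborel" by (auto intro!: borel_open)
  qed
  also have "\<dots> = V * (T + \<eta>)\<^sup>2" using T \<eta> by (intro ball) auto
  finally have "V * (real (card I) * \<eta>\<^sup>2) \<le> V * (T + \<eta>)\<^sup>2" by (simp add: mult_ac)
  then show ?thesis using V by (simp only: mult_le_cancel_left_pos)
qed

section \<open>The energy of cylinders under the open set condition\<close>

text \<open>The set \<open>U\<close> witnesses the open set condition; \<open>a\<close>, \<open>c\<close> and \<open>D\<close> fix a ball in it and its position
relative to \<open>C\<close>. The exponent \<open>s\<close> is the similarity dimension, so that \<open>\<lambda>j. r j powr s\<close> is a probability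
vector, and \<open>q\<close>, \<open>p\<close> enclose the ratios.\<close>

locale osc_system = similarity_system +
  fixes U C :: "(real^2) set" and a :: "real^2" and c D s q p :: real
  assumes osc: "j \<in> J \<Longrightarrow> f j ` U \<subseteq> U" "i \<in> J \<Longrightarrow> j \<in> J \<Longrightarrow> i \<noteq> j \<Longrightarrow> f i ` U \<inter> f j ` U = {}"
    and ball_U: "ball a c \<subseteq> U" and c: "0 < c" "c \<le> 1"
    and inv_C: "j \<in> J \<Longrightarrow> f j ` C \<subseteq> C" and C_nonempty: "C \<noteq> {}"
    and near_C: "x \<in> C \<Longrightarrow> dist a x \<le> D" and D: "1 \<le> D"
    and s: "1 \<le> s" "(\<Sum>j\<in>J. r j powr s) = 1"
    and qp: "0 < q" "p < 1" "j \<in> J \<Longrightarrow> q \<le> r j" "j \<in> J \<Longrightarrow> r j \<le> p"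
begin

lemma word_U: "set w \<subseteq> J \<Longrightarrow> foldr f w ` U \<subseteq> U"
  using word_invariant[of U w] osc(1) by blast

lemma incomparable_words_disjoint:
  assumes "set u \<subseteq> J" "set v \<subseteq> J" "\<not> prefix u v" "\<not> prefix v u"
  shows "foldr f u ` U \<inter> foldr f v ` U = {}"
  using assms
proof (induction u arbitrary: v)
  case (Cons i u)
  then obtain j v' where v: "v = j # v'" by (cases v) auto
  have u_sub: "foldr f (i # u) ` U \<subseteq> f i ` U" and v_sub: "foldr f v ` U \<subseteq> f j ` U"
    using word_U[of u] word_U[of v'] Cons.prems v by (auto simp: image_comp[symmetric])
  show ?case
  proof (cases "i = j")
    case True
    then have disj: "foldr f u ` U \<inter> foldr f v' ` U = {}" using Cons v by auto
    show ?thesis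
    proof (rule ccontr)
      assume "\<not> ?thesis"
      then obtain x y where xy: "x \<in> U" "y \<in> U" "f i (foldr f u x) = f i (foldr f v' y)"
        unfolding v True by auto
      then have "foldr f u x = foldr f v' y" using inj_word[of "[i]"] Cons.prems by simp
      then show False using disj xy by blast
    qed
  next
    case False
    then have "f i ` U \<inter> f j ` U = {}" using Cons.prems v by (intro osc(2)) auto
    then show ?thesis using u_sub v_sub by blast
  qed
qed simp

text \<open>The point \<open>a\<close> lies in the open set \<open>U\<close>, which gives incomparable words disjoint balls around their centres.\<close>

definition centre :: "nat list \<Rightarrow> real^2" where "centre w = foldr f w a"

lemma centre_append: "set u \<subseteq> J \<Longrightarrow> dist (centre u) (centre (u @ v)) = weight r u * dist a (centre v)"
  by (simp add: centre_def word_dist)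

lemma dist_centre: 
  assumes "set w \<subseteq> J" shows "dist a (centre w) \<le> 2 * D"
proof -
  obtain x where x: "x \<in> C" using C_nonempty by auto
  have "foldr f w x \<in> C" using word_invariant[OF inv_C assms x] .
  moreover have "weight r w \<le> 1" using weight_le_power[of J r 1 w] ratio assms by fastforce
  then have "dist (foldr f w a) (foldr f w x) \<le> 1 * dist a x"
    unfolding word_dist[OF assms] by (intro mult_right_mono) auto
  ultimately show ?thesis
    using near_C[OF x] near_C[of "foldr f w x"] dist_triangle[of a "centre w" "foldr f w x"]
    by (simp add: centre_def dist_commute)
qed

lemma incomparable_balls_disjoint:
  assumes "set u \<subseteq> J" "set v \<subseteq> J" "\<not> prefix u v" "\<not> prefix v u"
    and "\<eta> \<le> weight r u * c" "\<eta> \<le> weight r v * c"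
  shows "ball (centre u) \<eta> \<inter> ball (centre v) \<eta> = {}"
proof -
  have sub: "ball (centre w) \<eta> \<subseteq> foldr f w ` U" if "set w \<subseteq> J" "\<eta> \<le> weight r w * c" for w
  proof
    fix y assume "y \<in> ball (centre w) \<eta>"
    then have "dist (foldr f w a) y < weight r w * c" using that(2) by (simp add: centre_def)
    from word_ball[OF that(1) this] obtain x' where "y = foldr f w x'" "dist a x' < c" .
    then show "y \<in> foldr f w ` U" using ball_U by auto
  qed
  show ?thesis using sub[of u] sub[of v] incomparable_words_disjoint[of u v] assms by blast
qed

lemma p_weight_sum: "(\<Sum>w\<in>words J n. weight r w powr s) = 1"
proof -
  have "(\<Sum>w\<in>words J n. weight r w powr s) = (\<Sum>w\<in>words J n. weight (\<lambda>j. r j powr s) w)"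
    using ratio by (intro sum.cong) (auto simp: weight_powr[of J])
  then show ?thesis using sum_weight_words[OF finite_J, of "\<lambda>j. r j powr s"] s by simp
qed

text \<open>Stopping a word when its ratio first drops to \<open>t\<close> gives an antichain of words whose cylinders all have size
comparable to \<open>t\<close>.\<close>

definition stop_prefix :: "real \<Rightarrow> nat list \<Rightarrow> nat list" where
  "stop_prefix t w = take (LEAST k. weight r (take k w) \<le> t) w"

lemma stop_prefix:
  assumes w: "set w \<subseteq> J" "weight r w \<le> t" and t: "t < 1"
  shows "prefix (stop_prefix t w) w" "weight r (stop_prefix t w) \<le> t" "q * t \<le> weight r (stop_prefix t w)"
    "\<And>k. k < length (stop_prefix t w) \<Longrightarrow> t < weight r (take k w)"
proof -
  let ?P = "\<lambda>k. weight r (take k w) \<le> t"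
  define k where "k = (LEAST k. ?P k)"
  have P: "?P (length w)" using w by simp
  have k: "?P k" unfolding k_def using P by (rule LeastI)
  have below: "t < weight r (take i w)" if "i < k" for i
    using not_less_Least[of i ?P] that by (auto simp: k_def not_le)
  have kw: "k \<le> length w" unfolding k_def using P by (rule Least_le)
  have eq: "stop_prefix t w = take k w" by (simp add: stop_prefix_def k_def)
  show "prefix (stop_prefix t w) w" by (simp add: eq take_is_prefix)
  show "weight r (stop_prefix t w) \<le> t" using k by (simp add: eq)
  show "\<And>i. i < length (stop_prefix t w) \<Longrightarrow> t < weight r (take i w)" using below by (simp add: eq)
  have "k \<noteq> 0" using k t by (cases k) auto
  then obtain i where i: "k = Suc i" by (cases k) auto
  then have tk: "take k w = take i w @ [w ! i]" using kw by (simp add: take_Suc_conv_app_nth)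
  have wi: "w ! i \<in> J" using w(1) kw i by (auto simp: subset_iff)
  have "0 < weight r (take i w)" using w(1) set_take_subset[of i w] by (intro weight_r_pos) auto
  then have "t * q \<le> weight r (take i w) * r (w ! i)"
    using below[of i] i qp(1) qp(3)[OF wi] by (intro mult_mono) auto
  then show "q * t \<le> weight r (stop_prefix t w)" by (simp add: eq tk mult.commute)
qed

definition packing_const :: real where "packing_const = ((1 + 2 * D + q * c) / (q * c))\<^sup>2"

lemma packing_const_ge_1: "1 \<le> packing_const"
proof -
  have "1 \<le> (1 + 2 * D + q * c) / (q * c)" using qp(1) c D by (simp add: le_divide_eq)
  then show ?thesis unfolding packing_const_def by (intro one_le_power)
qed

text \<open>In the probability measure given by the weights \<open>r j powr s\<close>, each word of \<open>T\<close> has mass \<open>\<rho> powr s\<close> and all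
words with prefix \<open>u\<close> together have the mass of \<open>u\<close>.\<close>

lemma card_words_with_prefix:
  assumes T: "T \<subseteq> words J n" "\<And>w. w \<in> T \<Longrightarrow> weight r w = \<rho>" and u: "set u \<subseteq> J" "length u \<le> n"
  shows "real (card {w \<in> T. prefix u w}) * \<rho> powr s \<le> weight r u powr s"
proof -
  have fin: "finite (words J n)" using finite_J by (rule finite_words)
  have "real (card {w \<in> T. prefix u w}) * \<rho> powr s = (\<Sum>w\<in>{w \<in> T. prefix u w}. weight r w powr s)"
    using T(2) by simp
  also have "\<dots> \<le> (\<Sum>w\<in>(@) u ` words J (n - length u). weight r w powr s)"
  proof (rule sum_mono2)
    show "finite ((@) u ` words J (n - length u))" using finite_words[OF finite_J] by simp
    show "{w \<in> T. prefix u w} \<subseteq> (@) u ` words J (n - length u)"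
      using T(1) by (fastforce simp: prefix_def)
  qed auto
  also have "\<dots> = (\<Sum>v\<in>words J (n - length u). weight r (u @ v) powr s)"
    by (subst sum.reindex) (auto simp: inj_on_def)
  also have "\<dots> = (\<Sum>v\<in>words J (n - length u). weight r u powr s * weight r v powr s)"
    using weight_r_pos u(1) by (intro sum.cong) (auto simp: powr_mult less_imp_le)
  also have "\<dots> = weight r u powr s" using p_weight_sum[of "n - length u"] by (simp flip: sum_distrib_left)
  finally show ?thesis .
qed

text \<open>The words counted stop at scale \<open>t\<close> in prefixes whose cylinders contain disjoint balls of radius comparable to
\<open>t\<close> near \<open>centre v\<close>, so there is a bounded number of prefixes; each of them has mass at most \<open>t powr s\<close>.
For \<open>t \<ge> 1\<close> the total mass 1 is enough.\<close>

lemma card_close_centres: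
  assumes T: "T \<subseteq> words J n" "\<And>w. w \<in> T \<Longrightarrow> weight r w = \<rho>" and v: "v \<in> T" and t: "\<rho> \<le> t"
  shows "real (card {w \<in> T. dist (centre v) (centre w) \<le> t}) \<le> packing_const * (t / \<rho>) powr s"
proof -
  define B where "B = {w \<in> T. dist (centre v) (centre w) \<le> t}"
  have finT: "finite T" using T(1) finite_words[OF finite_J] by (rule finite_subset)
  then have finB: "finite B" by (simp add: B_def)
  have \<rho>: "0 < \<rho>" using weight_r_pos[of v] T v by auto
  have TJ: "set w \<subseteq> J" "length w = n" if "w \<in> T" for w using T(1) that by auto
  have "real (card B) * \<rho> powr s \<le> packing_const * t powr s"
  proof (cases "1 \<le> t")
    case True
    have "real (card B) * \<rho> powr s \<le> real (card {w \<in> T. prefix [] w}) * \<rho> powr s"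
      using finT by (intro mult_right_mono of_nat_mono card_mono) (auto simp: B_def)
    also have "\<dots> \<le> 1" using card_words_with_prefix[of T n \<rho> "[]"] T by simp
    also have "\<dots> \<le> packing_const * t powr s"
      using packing_const_ge_1 True s mult_mono[of 1 packing_const 1 "t powr s"] by (simp add: ge_one_powr_ge_zero)
    finally show ?thesis .
  next
    case False
    then have t1: "t < 1" by simp
    have t0: "t > 0" using \<rho> t by linarith
    define P where "P = stop_prefix t ` B"
    have finP: "finite P" using finB by (simp add: P_def)
    have sp: "prefix (stop_prefix t w) w" "weight r (stop_prefix t w) \<le> t" "q * t \<le> weight r (stop_prefix t w)"
      "\<And>k. k < length (stop_prefix t w) \<Longrightarrow> t < weight r (take k w)" if "w \<in> B" for w
    proof -
      have "w \<in> T" using that by (simp add: B_def)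
      then have w: "set w \<subseteq> J" "weight r w \<le> t" using TJ T(2) t by auto
      show "prefix (stop_prefix t w) w" "weight r (stop_prefix t w) \<le> t" "q * t \<le> weight r (stop_prefix t w)"
        "\<And>k. k < length (stop_prefix t w) \<Longrightarrow> t < weight r (take k w)"
        using stop_prefix[OF w t1] by blast+
    qed
    have PJ: "set u \<subseteq> J" "length u \<le> n" if "u \<in> P" for u
    proof -
      obtain w where w: "w \<in> B" "u = stop_prefix t w" using \<open>u \<in> P\<close> by (auto simp: P_def)
      show "set u \<subseteq> J" "length u \<le> n"
        using sp(1)[OF w(1)] TJ[of w] w set_mono_prefix prefix_length_le by (fastforce simp: B_def)+
    qed
    have antichain: "\<not> prefix u u'" if u: "u \<in> P" "u' \<in> P" "u \<noteq> u'" for u u'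
    proof
      assume pre: "prefix u u'"
      obtain w where w: "w \<in> B" "u = stop_prefix t w" using u by (auto simp: P_def)
      obtain w' where w': "w' \<in> B" "u' = stop_prefix t w'" using u by (auto simp: P_def)
      have "length u < length u'" using pre u(3) by (metis prefix_length_less strict_prefix_def)
      then have "t < weight r (take (length u) w')" using sp(4)[OF w'(1)] w'(2) by simp
      moreover have "prefix u w'" using pre sp(1)[OF w'(1)] w'(2) prefix_order.trans by metis
      then have "take (length u) w' = u" by (metis append_eq_conv_conj prefix_def)
      ultimately show False using sp(2)[OF w(1)] w(2) by simp
    qed
    have cardP: "real (card P) \<le> packing_const"
    proof -
      define \<eta> where "\<eta> = q * t * c"
      have \<eta>: "\<eta> > 0" using qp(1) t0 c by (simp add: \<eta>_def)
      have "real (card P) * \<eta>\<^sup>2 \<le> ((1 + 2 * D) * t + \<eta>)\<^sup>2"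
      proof (rule card_disjoint_balls[where x = centre and y = "centre v"])
        fix u u' assume u: "u \<in> P" "u' \<in> P" "u \<noteq> u'"
        have "\<eta> \<le> weight r u * c" if "u \<in> P" for u
          using that sp(3) c by (auto simp: P_def \<eta>_def)
        then show "ball (centre u) \<eta> \<inter> ball (centre u') \<eta> = {}"
          using u PJ antichain by (intro incomparable_balls_disjoint) auto
      next
        fix u assume "u \<in> P"
        then obtain w where w: "w \<in> B" "u = stop_prefix t w" by (auto simp: P_def)
        obtain x where x: "w = u @ x" using sp(1)[OF w(1)] w(2) by (auto simp: prefix_def)
        have "set w \<subseteq> J" using w(1) TJ by (auto simp: B_def)
        then have J: "set u \<subseteq> J" "set x \<subseteq> J" using x by auto
        have "dist (centre u) (centre w) = weight r u * dist a (centre x)"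
          unfolding x using J by (intro centre_append)
        also have "\<dots> \<le> t * (2 * D)"
          using sp(2)[OF w(1)] w(2) dist_centre[OF J(2)] t0 by (intro mult_mono) auto
        finally show "dist (centre v) (centre u) \<le> (1 + 2 * D) * t"
          using w(1) dist_triangle[of "centre v" "centre u" "centre w"]
          by (simp add: B_def dist_commute algebra_simps)
      qed (use finP \<eta> D t0 in auto)
      also have "\<dots> = ((1 + 2 * D + q * c) * t)\<^sup>2" by (simp add: \<eta>_def algebra_simps)
      finally have "real (card P) * (q * c)\<^sup>2 * t\<^sup>2 \<le> (1 + 2 * D + q * c)\<^sup>2 * t\<^sup>2"
        by (simp add: \<eta>_def power_mult_distrib mult_ac)
      then have "real (card P) * (q * c)\<^sup>2 \<le> (1 + 2 * D + q * c)\<^sup>2" using t0 by simp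
      moreover have "(q * c)\<^sup>2 > 0" using qp(1) c by simp
      ultimately show ?thesis unfolding packing_const_def power_divide by (simp only: le_divide_eq if_True)
    qed
    have "real (card B) = (\<Sum>u\<in>P. real (card {w\<in>B. stop_prefix t w = u}))"
      unfolding P_def using card_eq_sum sum.image_gen[OF finB, of "\<lambda>_. 1::real" "stop_prefix t"] by simp
    then have "real (card B) * \<rho> powr s = (\<Sum>u\<in>P. real (card {w\<in>B. stop_prefix t w = u}) * \<rho> powr s)"
      by (simp add: sum_distrib_right)
    also have "\<dots> \<le> (\<Sum>u\<in>P. t powr s)"
    proof (rule sum_mono)
      fix u assume u: "u \<in> P"
      have "card {w\<in>B. stop_prefix t w = u} \<le> card {w\<in>T. prefix u w}"
        using sp(1) finT by (intro card_mono) (auto simp: B_def)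
      then have "real (card {w\<in>B. stop_prefix t w = u}) * \<rho> powr s \<le> real (card {w\<in>T. prefix u w}) * \<rho> powr s"
        by (intro mult_right_mono) auto
      also have "\<dots> \<le> weight r u powr s" using T PJ[OF u] by (intro card_words_with_prefix) auto
      also have "\<dots> \<le> t powr s"
        using u sp(2) PJ[OF u] weight_r_pos[of u] s by (intro powr_mono2) (auto simp: P_def)
      finally show "real (card {w\<in>B. stop_prefix t w = u}) * \<rho> powr s \<le> t powr s" .
    qed
    also have "\<dots> \<le> packing_const * t powr s" using cardP by (simp add: mult_right_mono)
    finally show ?thesis .
  qed
  moreover have "t / \<rho> \<ge> 0" "t \<ge> 0" using \<rho> t by auto
  ultimately show ?thesis using \<rho> unfolding B_def[symmetric] by (simp add: powr_divide le_divide_eq)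
qed

lemma distinct_centres:
  assumes "T \<subseteq> words J n" "\<And>w. w \<in> T \<Longrightarrow> weight r w = \<rho>" "v \<in> T" "w \<in> T" "v \<noteq> w"
  shows "c * \<rho> \<le> dist (centre v) (centre w)" "dist (centre v) (centre w) \<le> 4 * D"
proof -
  have J: "set v \<subseteq> J" "set w \<subseteq> J" "length v = length w" using assms by auto
  have \<rho>: "0 < \<rho>" using weight_r_pos[of v] assms by auto
  have "\<not> prefix v w" "\<not> prefix w v" using J(3) assms(5) by (metis append_eq_append_conv append_Nil2 prefix_def)+
  then have "ball (centre v) (c * \<rho>) \<inter> ball (centre w) (c * \<rho>) = {}"
    using J assms by (intro incomparable_balls_disjoint) (auto simp: mult.commute)
  moreover have "centre w \<in> ball (centre w) (c * \<rho>)" using c \<rho> by simp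
  ultimately have "centre w \<notin> ball (centre v) (c * \<rho>)" by blast
  then show "c * \<rho> \<le> dist (centre v) (centre w)" by simp
  show "dist (centre v) (centre w) \<le> 4 * D"
    using dist_centre[OF J(1)] dist_centre[OF J(2)] dist_triangle2[of "centre v" "centre w" a]
    by (simp add: dist_commute)
qed

lemma dyadic_shell:
  fixes d :: real
  assumes "c * \<rho> \<le> d" "d \<le> 4 * D" "0 < \<rho>" "\<rho> \<le> 1"
  shows "\<exists>k::nat. d \<le> 2 ^ k * \<rho> \<and> c * (2 ^ k * \<rho>) / 2 \<le> d \<and> 2 ^ k * \<rho> \<le> 8 * D"
proof -
  let ?P = "\<lambda>k::nat. d \<le> 2 ^ k * \<rho>"
  obtain m where "d / \<rho> < 2 ^ m" using real_arch_pow[of 2 "d / \<rho>"] by auto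
  then have Pm: "?P m" using assms by (simp add: divide_less_eq)
  define k where "k = (LEAST k. ?P k)"
  have k: "?P k" unfolding k_def using Pm by (rule LeastI)
  show ?thesis
  proof (cases k)
    case 0
    have "c * \<rho> / 2 \<le> d" using assms(1,3) c(1) by (smt (verit) field_sum_of_halves mult_pos_pos)
    then show ?thesis using assms k 0 D by (intro exI[of _ 0]) auto
  next
    case (Suc i)
    then have "\<not> ?P i" using not_less_Least[of i ?P] by (simp add: k_def)
    then have i: "2 ^ i * \<rho> < d" by simp
    have "c * (2 ^ i * \<rho>) \<le> 1 * (2 ^ i * \<rho>)" using c assms by (intro mult_right_mono) auto
    moreover have "2 ^ k * \<rho> = 2 * (2 ^ i * \<rho>)" "c * (2 ^ k * \<rho>) / 2 = c * (2 ^ i * \<rho>)" by (simp_all add: Suc)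
    ultimately show ?thesis using i k assms(2) by (intro exI[of _ k] conjI) linarith+
  qed
qed

text \<open>Split into dyadic shells. In the shell of radius \<open>2 ^ k * \<rho>\<close> there are at most \<open>(2 ^ k) powr s\<close> centres up to a
constant, which contribute \<open>(2 ^ k) powr (s - 1) / \<rho>\<close>. As \<open>s \<ge> 1\<close>, the last shell gives the largest
contribution, \<open>\<rho> powr (- s)\<close>, and the number of shells is proportional to \<open>n\<close>.\<close>

lemma energy_bound:
  "\<exists>K>0. \<forall>n T \<rho>. 1 \<le> n \<longrightarrow> T \<subseteq> words J n \<longrightarrow> (\<forall>w\<in>T. weight r w = \<rho>) \<longrightarrow>
    (\<forall>v\<in>T. (\<Sum>w\<in>T - {v}. 1 / dist (centre v) (centre w)) \<le> K * real n * \<rho> powr (- s))"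
proof -
  obtain b1 where b1: "8 * D < 2 ^ b1" using real_arch_pow[of 2 "8 * D"] by auto
  obtain b2 where b2: "1 / q < 2 ^ b2" using real_arch_pow[of 2 "1 / q"] by auto
  \<comment> \<open>With this \<open>b\<close> all relevant shells have index at most \<open>b + b * n\<close>.\<close>
  define b where "b = Suc (max b1 b2)"
  have "(2::real) ^ b1 \<le> 2 ^ b" "(2::real) ^ b2 \<le> 2 ^ b" unfolding b_def by (rule power_increasing; simp)+
  then have b: "8 * D \<le> 2 ^ b" "1 / q \<le> 2 ^ b" "1 \<le> b" using b1 b2 by (auto simp: b_def)
  define K where "K = 3 * real b * (2 * packing_const / c * (8 * D) powr (s - 1))"
  have "0 < K" using b(3) packing_const_ge_1 c D by (simp add: K_def)
  moreover have "(\<Sum>w\<in>T - {v}. 1 / dist (centre v) (centre w)) \<le> K * real n * \<rho> powr (- s)"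
    if n: "1 \<le> n" and T: "T \<subseteq> words J n" "\<And>w. w \<in> T \<Longrightarrow> weight r w = \<rho>" and v: "v \<in> T" for n T \<rho> v
  proof -
    have finT: "finite T" using T(1) finite_words[OF finite_J] by (rule finite_subset)
    have vJ: "set v \<subseteq> J" "length v = n" "weight r v = \<rho>" using T v by auto
    have \<rho>: "0 < \<rho>" using weight_r_pos[OF vJ(1)] vJ(3) by simp
    have \<rho>1: "\<rho> \<le> 1" using weight_le_power[of J r 1 v] ratio vJ by fastforce
    have \<rho>q: "q ^ n \<le> \<rho>" using weight_ge_power[of J q r v] qp vJ by auto
    define S where "S = {k::nat. 2 ^ k * \<rho> \<le> 8 * D}"
    have "S \<subseteq> {..b + b * n}"
    proof
      fix k assume "k \<in> S"
      then have "2 ^ k * \<rho> \<le> 8 * D" by (simp add: S_def)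
      moreover have "2 ^ k * q ^ n \<le> 2 ^ k * \<rho>" using \<rho>q by (rule mult_left_mono) simp
      ultimately have "2 ^ k * q ^ n \<le> 8 * D" by linarith
      then have "2 ^ k \<le> 8 * D * (1 / q) ^ n" using qp(1) by (simp add: power_one_over field_simps)
      also have "\<dots> \<le> 2 ^ b * (2 ^ b) ^ n" using b qp(1) by (intro mult_mono power_mono) auto
      finally have "(2::real) ^ k \<le> 2 ^ (b + b * n)" by (simp add: power_add power_mult)
      then show "k \<in> {..b + b * n}" by simp
    qed
    then have finS: "finite S" and cardS': "card S \<le> card {..b + b * n}"
      by (auto intro: finite_subset simp del: card_atMost intro!: card_mono)
    moreover have "b + b * n + 1 \<le> 3 * b * n"
    proof -
      have "1 * 1 \<le> b * n" "b * 1 \<le> b * n" using n b(3) by (intro mult_le_mono; simp)+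
      then show ?thesis unfolding mult.assoc by linarith
    qed
    ultimately have "card S \<le> 3 * b * n" using cardS' by simp
    then have cardS: "real (card S) \<le> 3 * real b * real n" by (metis of_nat_le_iff of_nat_mult of_nat_numeral)
    have "(\<Sum>w\<in>T - {v}. 1 / dist (centre v) (centre w))
        \<le> (\<Sum>w\<in>T - {v}. \<Sum>k\<in>S. of_bool (dist (centre v) (centre w) \<le> 2 ^ k * \<rho>) * (2 / (c * (2 ^ k * \<rho>))))"
    proof (rule sum_mono)
      fix w assume w: "w \<in> T - {v}"
      let ?d = "dist (centre v) (centre w)"
      have d: "c * \<rho> \<le> ?d" "?d \<le> 4 * D" using distinct_centres[OF T v, of w] w by auto
      obtain k where k: "?d \<le> 2 ^ k * \<rho>" "c * (2 ^ k * \<rho>) / 2 \<le> ?d" "2 ^ k * \<rho> \<le> 8 * D"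
        using dyadic_shell[OF d \<rho> \<rho>1] by blast
      have pos: "c * (2 ^ k * \<rho>) / 2 > 0" using c \<rho> by simp
      have "1 / ?d \<le> 1 / (c * (2 ^ k * \<rho>) / 2)" using k(2) pos by (intro frac_le) auto
      also have "\<dots> = of_bool (?d \<le> 2 ^ k * \<rho>) * (2 / (c * (2 ^ k * \<rho>)))" using k(1) by simp
      also have "\<dots> \<le> (\<Sum>k\<in>S. of_bool (?d \<le> 2 ^ k * \<rho>) * (2 / (c * (2 ^ k * \<rho>))))"
        using k(3) finS c \<rho> by (intro member_le_sum) (auto simp: S_def)
      finally show "1 / ?d \<le> (\<Sum>k\<in>S. of_bool (?d \<le> 2 ^ k * \<rho>) * (2 / (c * (2 ^ k * \<rho>))))" .
    qed
    also have "\<dots> = (\<Sum>k\<in>S. 2 / (c * (2 ^ k * \<rho>)) * real (card {w \<in> T - {v}. dist (centre v) (centre w) \<le> 2 ^ k * \<rho>}))"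
    proof -
      have count: "(\<Sum>w\<in>T - {v}. of_bool (dist (centre v) (centre w) \<le> t))
          = real (card {w \<in> T - {v}. dist (centre v) (centre w) \<le> t})" for t
        using finT by (subst sum_of_bool_eq) (auto intro!: arg_cong[where f=card])
      show ?thesis
        by (subst sum.swap) (intro sum.cong refl, simp only: sum_distrib_right[symmetric] count, rule mult.commute)
    qed
    also have "\<dots> \<le> (\<Sum>k\<in>S. 2 * packing_const / c * (8 * D) powr (s - 1) * \<rho> powr (- s))"
    proof (rule sum_mono)
      fix k assume k: "k \<in> S"
      have x: "(2::real) ^ k > 0" by simp
      have "card {w \<in> T - {v}. dist (centre v) (centre w) \<le> 2 ^ k * \<rho>}
          \<le> card {w \<in> T. dist (centre v) (centre w) \<le> 2 ^ k * \<rho>}"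
        using finT by (intro card_mono) auto
      then have "real (card {w \<in> T - {v}. dist (centre v) (centre w) \<le> 2 ^ k * \<rho>})
          \<le> real (card {w \<in> T. dist (centre v) (centre w) \<le> 2 ^ k * \<rho>})" by simp
      also have "\<dots> \<le> packing_const * (2 ^ k * \<rho> / \<rho>) powr s"
        using \<rho> by (intro card_close_centres[OF T v]) auto
      also have "2 ^ k * \<rho> / \<rho> = 2 ^ k" using \<rho> by simp
      finally have "2 / (c * (2 ^ k * \<rho>)) * real (card {w \<in> T - {v}. dist (centre v) (centre w) \<le> 2 ^ k * \<rho>})
         \<le> 2 / (c * (2 ^ k * \<rho>)) * (packing_const * (2 ^ k) powr s)"
        using c \<rho> by (intro mult_left_mono) auto
      also have "\<dots> = 2 * packing_const / c * ((2 ^ k) powr s / 2 ^ k) * (1 / \<rho>)" by simp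
      also have "(2 ^ k) powr s / 2 ^ k = (2 ^ k :: real) powr (s - 1)" by (simp add: powr_diff)
      also have "2 * packing_const / c * (2 ^ k) powr (s - 1) * (1 / \<rho>)
         \<le> 2 * packing_const / c * (8 * D / \<rho>) powr (s - 1) * (1 / \<rho>)"
        using k \<rho> c s packing_const_ge_1
        by (intro mult_right_mono mult_left_mono powr_mono2) (auto simp: S_def le_divide_eq)
      also have "(8 * D / \<rho>) powr (s - 1) = (8 * D) powr (s - 1) * \<rho> powr (1 - s)"
        using D \<rho> by (simp add: powr_divide powr_minus_divide[of _ "s - 1", simplified])
      also have "2 * packing_const / c * ((8 * D) powr (s - 1) * \<rho> powr (1 - s)) * (1 / \<rho>)
         = 2 * packing_const / c * (8 * D) powr (s - 1) * (\<rho> powr (1 - s) / \<rho>)" by simp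
      also have "\<rho> powr (1 - s) / \<rho> = \<rho> powr (- s)" using \<rho> by (simp add: powr_diff powr_minus_divide)
      finally show "2 / (c * (2 ^ k * \<rho>)) * real (card {w \<in> T - {v}. dist (centre v) (centre w) \<le> 2 ^ k * \<rho>})
         \<le> 2 * packing_const / c * (8 * D) powr (s - 1) * \<rho> powr (- s)" .
    qed
    also have "\<dots> = real (card S) * (2 * packing_const / c * (8 * D) powr (s - 1) * \<rho> powr (- s))" by simp
    also have "\<dots> \<le> (3 * real b * real n) * (2 * packing_const / c * (8 * D) powr (s - 1) * \<rho> powr (- s))"
      using cardS packing_const_ge_1 c by (intro mult_right_mono) auto
    also have "\<dots> = K * real n * \<rho> powr (- s)" by (simp add: K_def)
    finally show ?thesis .
  qed
  ultimately show ?thesis by (intro exI[of _ K]) auto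
qed

text \<open>Words with the same letters have the same ratio and the same rotation.\<close>

lemma homothetic_words:
  assumes "1 \<le> n"
  obtains T \<rho> R where "T \<subseteq> words J n" "T \<noteq> {}" "\<forall>w\<in>T. weight r w = \<rho>" "\<forall>w\<in>T. rot w = R"
    "1 \<le> real (card T) * \<rho> powr s * real ((n + 1) ^ card J)" "q ^ n \<le> \<rho>" "\<rho> \<le> p ^ n" "rotation_matrix R"
proof -
  obtain M where M: "1 / real ((n + 1) ^ card J) \<le> (\<Sum>w\<in>{w \<in> words J n. mset w = M}. weight (\<lambda>j. r j powr s) w)"
    using heavy_letter_class[OF finite_J s(2)] .
  define T where "T = {w \<in> words J n. mset w = M}"
  have "(0::real) < 1 / real ((n + 1) ^ card J)" by simp
  then have "T \<noteq> {}" using M T_def by (metis less_le_not_le sum.empty)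
  then obtain v where v: "v \<in> T" by auto
  have vJ: "set v \<subseteq> J" "length v = n" using v by (auto simp: T_def)
  show ?thesis
  proof
    show "T \<subseteq> words J n" by (auto simp: T_def)
    show "T \<noteq> {}" by fact
    show wt: "\<forall>w\<in>T. weight r w = weight r v"
      using v by (simp add: T_def flip: prod_mset_prod_list)
    show "\<forall>w\<in>T. rot w = rot v"
      using v by (auto intro!: rot_depends_on_letters simp: T_def)
    have "(\<Sum>w\<in>T. weight (\<lambda>j. r j powr s) w) = (\<Sum>w\<in>T. weight r v powr s)"
      using ratio wt by (intro sum.cong) (auto simp: T_def weight_powr[of J])
    then have "1 / real ((n + 1) ^ card J) \<le> real (card T) * weight r v powr s" using M by (simp add: T_def)
    then show "1 \<le> real (card T) * weight r v powr s * real ((n + 1) ^ card J)"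
      by (simp only: divide_le_eq of_nat_0_less_iff zero_less_power add_gr_0 zero_less_one if_True simp_thms)
    show "q ^ n \<le> weight r v" using weight_ge_power[of J q r v] qp vJ by auto
    show "weight r v \<le> p ^ n" using weight_le_power[of J r p v] qp ratio vJ by auto
    show "rotation_matrix (rot v)" using vJ(1) by (rule rotation_rot)
  qed
qed

end

section \<open>Orbits with large averages at all times\<close>

text \<open>Let \<open>m\<close> be a place where the partial sums of \<open>a j - (c - \<delta>)\<close> are smallest; from there on they never fall below
their value at \<open>m\<close>. The place cannot be close to \<open>n\<close>, because the sums have to climb from at most 0 to at least \<open>n * \<delta>\<close> in bounded steps.\<close>

lemma exists_leader:
  fixes a :: "nat \<Rightarrow> real"
  assumes A: "\<And>j. j < n \<Longrightarrow> a j \<le> B" and sum: "real n * c \<le> (\<Sum>j<n. a j)" and \<delta>: "\<delta> > 0"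
  obtains m where "m \<le> n" "real n * \<delta> \<le> real (n - m) * (B - c + \<delta>)"
    "\<And>k. k \<le> n - m \<Longrightarrow> real k * (c - \<delta>) \<le> (\<Sum>i<k. a (m + i))"
proof -
  define S where "S k = (\<Sum>j<k. a j - c + \<delta>)" for k
  define m where "m = arg_min_on S {..n}"
  have m: "m \<in> {..n}" unfolding m_def by (intro arg_min_if_finite) auto
  have min: "S m \<le> S k" if "k \<le> n" for k unfolding m_def using that by (intro arg_min_least) auto
  have split: "S (m + k) = S m + (\<Sum>i<k. a (m + i) - c + \<delta>)" for k
    by (induction k) (auto simp: S_def)
  show ?thesis
  proof
    show "m \<le> n" using m by auto
    have "real n * \<delta> \<le> S n" using sum by (simp add: S_def sum.distrib sum_subtractf algebra_simps)
    also have "\<dots> = S m + (\<Sum>i<n-m. a (m + i) - c + \<delta>)" using split[of "n - m"] m by simp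
    also have "\<dots> \<le> S m + real (n - m) * (B - c + \<delta>)"
      using sum_bounded_above[of "{..<n-m}" "\<lambda>i. a (m + i) - c + \<delta>" "B - c + \<delta>"] A by (auto simp: less_diff_conv add_ac)
    also have "S m \<le> 0" using min[of 0] by (simp add: S_def)
    finally show "real n * \<delta> \<le> real (n - m) * (B - c + \<delta>)" by simp
    fix k assume "k \<le> n - m"
    then have "S m \<le> S (m + k)" using m by (intro min) auto
    then show "real k * (c - \<delta>) \<le> (\<Sum>i<k. a (m + i))"
      unfolding split by (simp add: sum.distrib sum_subtractf algebra_simps)
  qed
qed

text \<open>This replaces the ergodic theorem: averages that are large on a whole block give, by passing to a leader, a point
whose averages are large at all times up to a given bound. A limit of such points, as the bound grows, is good for all times,
because upper semicontinuity only increases the sums in the limit.\<close>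

lemma good_orbit_exists:
  fixes \<phi> :: "'a::metric_space \<Rightarrow> real" and g :: "'a \<Rightarrow> 'a"
  assumes K: "compact K" and g: "continuous_on UNIV g" "g ` K \<subseteq> K"
    and usc: "\<And>x. eventually (\<lambda>y. \<phi> y \<le> \<phi> x) (nhds x)"
    and B: "\<And>x. \<phi> x \<le> B"
    and avg: "\<And>n. \<exists>x\<in>K. real n * c \<le> (\<Sum>i<n. \<phi> ((g ^^ i) x))" and \<delta>: "\<delta> > 0"
  shows "\<exists>x\<in>K. \<forall>k. real k * (c - \<delta>) \<le> (\<Sum>i<k. \<phi> ((g ^^ i) x))"
proof -
  have gK: "(g ^^ i) x \<in> K" if "x \<in> K" for i x
    using that g(2) by (induction i) auto
  have finite_good: "\<exists>x\<in>K. \<forall>k\<le>p. real k * (c - \<delta>) \<le> (\<Sum>i<k. \<phi> ((g ^^ i) x))" for p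
  proof -
    obtain n :: nat where n: "real p * (\<bar>B - c\<bar> + \<delta>) < real n * \<delta>"
      using \<delta> reals_Archimedean3 by blast
    obtain x where x: "x \<in> K" "real n * c \<le> (\<Sum>i<n. \<phi> ((g ^^ i) x))" using avg by blast
    obtain m where m: "m \<le> n" "real n * \<delta> \<le> real (n - m) * (B - c + \<delta>)"
      "\<And>k. k \<le> n - m \<Longrightarrow> real k * (c - \<delta>) \<le> (\<Sum>i<k. \<phi> ((g ^^ (m + i)) x))"
      using exists_leader[of n "\<lambda>i. \<phi> ((g ^^ i) x)" B c \<delta>] B x(2) \<delta> by blast
    have "real (n - m) * (B - c + \<delta>) \<le> real (n - m) * (\<bar>B - c\<bar> + \<delta>)" by (intro mult_left_mono) auto
    then have "real p * (\<bar>B - c\<bar> + \<delta>) < real (n - m) * (\<bar>B - c\<bar> + \<delta>)" using n m(2) by linarith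
    then have "real p < real (n - m)" using \<delta> by (simp add: mult_less_cancel_right)
    then have "p \<le> n - m" by simp
    then have "real k * (c - \<delta>) \<le> (\<Sum>i<k. \<phi> ((g ^^ i) ((g ^^ m) x)))" if "k \<le> p" for k
      using m(3)[of k] that by (simp add: funpow_add add.commute[of m])
    then show ?thesis using gK[OF x(1)] by blast
  qed
  then obtain X where X: "\<And>p. X p \<in> K" "\<And>p k. k \<le> p \<Longrightarrow> real k * (c - \<delta>) \<le> (\<Sum>i<k. \<phi> ((g ^^ i) (X p)))"
    by metis
  obtain x r where x: "x \<in> K" and r: "strict_mono r" "(X \<circ> r) \<longlonglongrightarrow> x"
    using K X(1) unfolding compact_def by blast
  have cont: "continuous_on UNIV (g ^^ i)" for i
    by (induction i) (auto intro!: continuous_on_compose2[OF g(1)] continuous_on_id simp: o_def id_def)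
  have "real k * (c - \<delta>) \<le> (\<Sum>i<k. \<phi> ((g ^^ i) x))" for k
  proof -
    have ev: "eventually (\<lambda>p. \<phi> ((g ^^ i) (X (r p))) \<le> \<phi> ((g ^^ i) x)) sequentially" for i
    proof -
      have "isCont (g ^^ i) x" using cont[of i] by (simp add: continuous_on_eq_continuous_at)
      then have "(\<lambda>p. (g ^^ i) ((X \<circ> r) p)) \<longlonglongrightarrow> (g ^^ i) x"
        using r(2) by (rule isCont_tendsto_compose)
      then show ?thesis using eventually_compose_filterlim[OF usc] by fastforce
    qed
    have "eventually (\<lambda>p. \<forall>i\<in>{..<k}. \<phi> ((g ^^ i) (X (r p))) \<le> \<phi> ((g ^^ i) x)) sequentially"
      by (intro eventually_ball_finite) (auto simp: ev)
    then have "eventually (\<lambda>p. k \<le> p \<and> (\<forall>i\<in>{..<k}. \<phi> ((g ^^ i) (X (r p))) \<le> \<phi> ((g ^^ i) x))) sequentially"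
      using eventually_ge_at_top[of k] by eventually_elim auto
    then obtain p where p: "k \<le> p" "\<forall>i\<in>{..<k}. \<phi> ((g ^^ i) (X (r p))) \<le> \<phi> ((g ^^ i) x)"
      unfolding eventually_sequentially by blast
    have "k \<le> r p" using p(1) seq_suble[OF r(1), of p] by linarith
    then have "real k * (c - \<delta>) \<le> (\<Sum>i<k. \<phi> ((g ^^ i) (X (r p))))" by (rule X(2))
    also have "\<dots> \<le> (\<Sum>i<k. \<phi> ((g ^^ i) x))" using p(2) by (intro sum_mono) auto
    finally show ?thesis .
  qed
  then show ?thesis using x by blast
qed

section \<open>Moran sets and their Hausdorff dimension\<close>

text \<open>The choices \<open>W i\<close> may depend on the level \<open>i\<close>, but not on the earlier choices.\<close>

definition branches :: "(nat \<Rightarrow> 'w set) \<Rightarrow> nat \<Rightarrow> 'w list set" where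
  "branches W k = {ws. length ws = k \<and> (\<forall>i<k. ws ! i \<in> W i)}"

lemma branches_0 [simp]: "branches W 0 = {[]}"
  by (auto simp: branches_def)

lemma branches_Suc: "branches W (Suc k) = (\<lambda>(ws, w). ws @ [w]) ` (branches W k \<times> W k)"
proof (intro equalityI subsetI)
  fix us assume us: "us \<in> branches W (Suc k)"
  then have "us \<noteq> []" "length us = Suc k" "us ! k \<in> W k" by (auto simp: branches_def)
  then have "us = butlast us @ [last us]" "last us \<in> W k" by (simp, simp add: last_conv_nth)
  moreover have "butlast us \<in> branches W k" using us by (auto simp: branches_def nth_butlast)
  ultimately show "us \<in> (\<lambda>(ws, w). ws @ [w]) ` (branches W k \<times> W k)" by force
qed (auto simp: branches_def nth_append less_Suc_eq)

lemma branches_Cons: "w # ws \<in> branches W (Suc k) \<longleftrightarrow> w \<in> W 0 \<and> ws \<in> branches (\<lambda>i. W (Suc i)) k"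
  by (auto simp: branches_def less_Suc_eq_0_disj)

lemma finite_branches: "(\<And>i. finite (W i)) \<Longrightarrow> finite (branches W k)"
  by (induction k) (auto simp: branches_Suc)

lemma card_branches:
  assumes "\<And>i. finite (W i)" shows "card (branches W k) = (\<Prod>i<k. card (W i))"
proof (induction k)
  case (Suc k)
  have "inj_on (\<lambda>(ws, w). ws @ [w]) (branches W k \<times> W k)" by (auto simp: inj_on_def)
  then show ?case using Suc by (simp add: branches_Suc card_image card_cartesian_product)
qed simp

lemma take_branches: "ws \<in> branches W m \<Longrightarrow> k \<le> m \<Longrightarrow> take k ws \<in> branches W k"
  by (auto simp: branches_def)

lemma card_branches_with_prefix:
  assumes fin: "\<And>i. finite (W i)" and km: "k \<le> m"
  shows "card {ws \<in> branches W m. take k ws = u} * card (branches W k) \<le> card (branches W m)"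
proof -
  let ?V = "\<lambda>i. W (k + i)"
  have "inj_on (drop k) {ws \<in> branches W m. take k ws = u}"
    by (rule inj_onI) (metis (mono_tags, lifting) append_take_drop_id mem_Collect_eq)
  moreover have "drop k ` {ws \<in> branches W m. take k ws = u} \<subseteq> branches ?V (m - k)"
    using km by (auto simp: branches_def)
  ultimately have "card {ws \<in> branches W m. take k ws = u} \<le> card (branches ?V (m - k))"
    using finite_branches[of ?V "m - k"] fin by (intro card_inj_on_le) auto
  then have "card {ws \<in> branches W m. take k ws = u} * card (branches W k)
      \<le> (\<Prod>i<m-k. card (W (k + i))) * (\<Prod>i<k. card (W i))"
    using fin by (simp add: card_branches)
  also have "\<dots> = (\<Prod>i<m. card (W i))"
    using km prod.atLeastLessThan_concat[of 0 k m "\<lambda>i. card (W i)"] prod.shift_bounds_nat_ivl[of "\<lambda>i. card (W i)" 0 k "m - k"]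
    by (simp add: lessThan_atLeast0 mult.commute add.commute)
  finally show ?thesis using fin by (simp add: card_branches)
qed

text \<open>\<open>P ws\<close> is the piece reached along the branch \<open>ws\<close>. The gap condition compares whole branches of the same
length, so it also limits how many pieces of level \<open>k\<close> a set of diameter less than
\<open>\<rho> ^ k\<close> can meet: at most one.\<close>

locale moran_construction =
  fixes W :: "nat \<Rightarrow> 'w set" and P :: "'w list \<Rightarrow> 'a::heine_borel set" and \<rho> \<sigma> :: real
  assumes finite_W: "finite (W i)" and W_nonempty: "W i \<noteq> {}"
    and piece: "ws \<in> branches W k \<Longrightarrow> compact (P ws) \<and> P ws \<noteq> {}"
    and nested: "ws \<in> branches W k \<Longrightarrow> w \<in> W k \<Longrightarrow> P (ws @ [w]) \<subseteq> P ws"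
    and gap: "\<lbrakk>ws \<in> branches W k; vs \<in> branches W k; ws \<noteq> vs; x \<in> P ws; y \<in> P vs\<rbrakk> \<Longrightarrow> \<rho> ^ k \<le> dist x y"
    and growth: "(1 / \<rho> ^ k) powr \<sigma> \<le> (\<Prod>i<k. real (card (W i)))"
    and \<rho>: "0 < \<rho>" "\<rho> < 1" and \<sigma>: "0 < \<sigma>"
begin

definition level :: "nat \<Rightarrow> 'a set" where "level k = (\<Union>ws\<in>branches W k. P ws)"

definition limit_set :: "'a set" where "limit_set = (\<Inter>k. level k)"

lemma piece_prefix: "ws \<in> branches W m \<Longrightarrow> k \<le> m \<Longrightarrow> P ws \<subseteq> P (take k ws)"
proof (induction m arbitrary: ws)
  case (Suc m)
  show ?case
  proof (cases "k = Suc m")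
    case True
    then show ?thesis using Suc.prems by (auto simp: branches_def)
  next
    case False
    obtain us w where us: "ws = us @ [w]" "us \<in> branches W m" "w \<in> W m"
      using Suc.prems(1) by (auto simp: branches_Suc)
    have "P ws \<subseteq> P us" unfolding us(1) using us by (intro nested)
    moreover have "P us \<subseteq> P (take k us)" using Suc.IH[OF us(2)] Suc.prems False by simp
    moreover have "take k ws = take k us" using us Suc.prems False by (auto simp: branches_def)
    ultimately show ?thesis by simp
  qed
qed simp

lemma compact_level: "compact (level k)"
  unfolding level_def using finite_branches[OF finite_W] piece by (intro compact_UN) auto

lemma level_antimono: "k \<le> m \<Longrightarrow> level m \<subseteq> level k"
  unfolding level_def using piece_prefix take_branches by fast

lemma compact_limit_set: "compact limit_set"
proof -
  have "closed limit_set"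
    unfolding limit_set_def using compact_level by (intro closed_INT) (auto intro: compact_imp_closed)
  moreover have "limit_set \<subseteq> level 0" by (auto simp: limit_set_def)
  ultimately show ?thesis using compact_level[of 0] compact_Int_closed[of "level 0" limit_set]
    by (simp add: Int_absorb1)
qed

lemma card_W_pos: "card (branches W k) > 0"
proof -
  have "\<forall>i. card (W i) > 0" using finite_W W_nonempty by (auto simp: card_gt_0_iff)
  then show ?thesis by (simp add: card_branches[OF finite_W] prod_pos)
qed

lemma eventually_level_subset:
  assumes "open V" "limit_set \<subseteq> V"
  shows "\<exists>m. level m \<subseteq> V"
proof (rule ccontr)
  assume "\<not> ?thesis"
  then have ne: "level m - V \<noteq> {}" for m by auto
  have "\<Inter> (range (\<lambda>m. level m - V)) \<noteq> {}"
  proof (rule compact_nest)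
    show "compact (level m - V)" for m using compact_level assms(1) by (rule compact_diff)
    show "level n - V \<subseteq> level m - V" if "m \<le> n" for m n using level_antimono[OF that] by blast
  qed (rule ne)
  then show False using assms(2) by (auto simp: limit_set_def)
qed

lemma scale_of_length:
  assumes "0 < e" "e < 1"
  obtains k where "\<rho> ^ Suc k \<le> e" "e < \<rho> ^ k"
proof -
  obtain m where m: "\<rho> ^ m < e" using real_arch_pow_inv[OF assms(1) \<rho>(2)] by auto
  define l where "l = (LEAST l. \<rho> ^ l \<le> e)"
  have l: "\<rho> ^ l \<le> e" unfolding l_def using less_imp_le[OF m] by (rule LeastI)
  then have "l \<noteq> 0" using assms(2) by (cases l) auto
  then obtain k where k: "l = Suc k" by (cases l) auto
  then have "\<not> \<rho> ^ k \<le> e" using not_less_Least[of k "\<lambda>l. \<rho> ^ l \<le> e"] by (simp add: l_def)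
  then show ?thesis using that[of k] l k by simp
qed

text \<open>Counting replaces the natural measure on the limit set. Choose a level \<open>m\<close> finer than all covering sets. A set of
size just below \<open>\<rho> ^ k\<close> meets pieces with one prefix of length \<open>k\<close> only, which is a fraction
of at most \<open>(\<rho> ^ k) powr \<sigma>\<close> of all pieces of level \<open>m\<close>, by the growth condition; the fractions add up to at least 1.\<close>

lemma cover_sum_lower_bound:
  fixes V :: "'i \<Rightarrow> 'a set"
  assumes I: "finite I" and V: "\<And>i. i \<in> I \<Longrightarrow> open (V i)" "limit_set \<subseteq> (\<Union>i\<in>I. V i)"
    and e: "\<And>i. i \<in> I \<Longrightarrow> 0 < e i" "\<And>i x y. i \<in> I \<Longrightarrow> x \<in> V i \<Longrightarrow> y \<in> V i \<Longrightarrow> dist x y \<le> e i"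
  shows "\<rho> powr \<sigma> \<le> (\<Sum>i\<in>I. e i powr \<sigma>)"
proof (cases "\<exists>i\<in>I. 1 \<le> e i")
  case True
  then obtain i where i: "i \<in> I" "1 \<le> e i" by auto
  have "\<rho> powr \<sigma> \<le> e i powr \<sigma>" using \<rho> \<sigma> i by (intro powr_mono2) auto
  also have "\<dots> \<le> (\<Sum>i\<in>I. e i powr \<sigma>)" using I i(1) by (intro member_le_sum) auto
  finally show ?thesis .
next
  case False
  then have "\<exists>k. \<rho> ^ Suc k \<le> e i \<and> e i < \<rho> ^ k" if "i \<in> I" for i
    using that e(1)[OF that] scale_of_length[of "e i"] by (metis not_le)
  then obtain k where k: "\<And>i. i \<in> I \<Longrightarrow> \<rho> ^ Suc (k i) \<le> e i" "\<And>i. i \<in> I \<Longrightarrow> e i < \<rho> ^ k i" by metis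
  obtain m0 where m0: "level m0 \<subseteq> (\<Union>i\<in>I. V i)"
    using eventually_level_subset[of "\<Union>i\<in>I. V i"] V by auto
  define m where "m = m0 + (\<Sum>i\<in>I. k i)"
  have km: "k i \<le> m" if "i \<in> I" for i
    using member_le_sum[of i I k] that I by (simp add: m_def)
  have lev: "level m \<subseteq> (\<Union>i\<in>I. V i)" using level_antimono[of m0 m] m0 by (auto simp: m_def)
  define N where "N l = real (card (branches W l))" for l
  have N: "N l > 0" for l using card_W_pos[of l] by (simp add: N_def)
  have finB: "finite (branches W l)" for l by (rule finite_branches[OF finite_W])
  define x where "x ws = (SOME x. x \<in> P ws)" for ws
  have x: "x ws \<in> P ws" if "ws \<in> branches W m" for ws
  proof -
    have "\<exists>y. y \<in> P ws" using piece[OF that] by auto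
    then show ?thesis unfolding x_def by (rule someI_ex)
  qed
  define H where "H i = {ws \<in> branches W m. x ws \<in> V i}" for i
  have "branches W m \<subseteq> (\<Union>i\<in>I. H i)" using x lev by (auto simp: H_def level_def)
  then have "card (branches W m) \<le> card (\<Union>i\<in>I. H i)"
    using I finB by (intro card_mono) (auto simp: H_def)
  also have "\<dots> \<le> (\<Sum>i\<in>I. card (H i))" using I by (rule card_UN_le)
  finally have "N m \<le> (\<Sum>i\<in>I. real (card (H i)))" unfolding N_def by (metis of_nat_le_iff of_nat_sum)
  also have "\<dots> \<le> (\<Sum>i\<in>I. N m * (e i powr \<sigma> / \<rho> powr \<sigma>))"
  proof (rule sum_mono)
    fix i assume i: "i \<in> I"
    show "real (card (H i)) \<le> N m * (e i powr \<sigma> / \<rho> powr \<sigma>)"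
    proof (cases "H i = {}")
      case True
      then show ?thesis using N[of m] by simp
    next
      case False
      then obtain v where v: "v \<in> H i" by auto
      have same: "take (k i) ws = take (k i) v" if "ws \<in> H i" for ws
      proof (rule ccontr)
        assume ne: "take (k i) ws \<noteq> take (k i) v"
        have ws: "ws \<in> branches W m" "x ws \<in> V i" and vs: "v \<in> branches W m" "x v \<in> V i"
          using that v by (auto simp: H_def)
        have "x ws \<in> P (take (k i) ws)" "x v \<in> P (take (k i) v)"
          using x piece_prefix[OF _ km[OF i]] ws vs by blast+
        then have "\<rho> ^ k i \<le> dist (x ws) (x v)"
          using gap[OF take_branches take_branches ne] ws vs km[OF i] by blast
        also have "\<dots> \<le> e i" using e(2)[OF i] ws vs by blast
        finally show False using k(2)[OF i] by simp
      qed
      have "card (H i) \<le> card {ws \<in> branches W m. take (k i) ws = take (k i) v}"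
        using same finB by (intro card_mono) (auto simp: H_def)
      then have "card (H i) * card (branches W (k i)) \<le> card (branches W m)"
        using card_branches_with_prefix[where W=W and u="take (k i) v", OF finite_W km[OF i]] le_trans mult_le_mono1 by blast
      then have "real (card (H i)) * N (k i) \<le> N m" unfolding N_def by (metis of_nat_le_iff of_nat_mult)
      then have "real (card (H i)) \<le> N m / N (k i)" using N by (simp add: le_divide_eq)
      also have "\<dots> \<le> N m / ((1 / \<rho> ^ k i) powr \<sigma>)"
        using growth[of "k i"] N[of m] N[of "k i"] \<rho> by (intro divide_left_mono mult_pos_pos) (auto simp: N_def card_branches[OF finite_W])
      also have "\<dots> = N m * (\<rho> ^ k i) powr \<sigma>" using \<rho> by (simp add: powr_divide)
      also have "\<dots> \<le> N m * (e i powr \<sigma> / \<rho> powr \<sigma>)"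
      proof -
        have "(\<rho> ^ k i) powr \<sigma> \<le> (e i / \<rho>) powr \<sigma>"
          using k(1)[OF i] \<rho> \<sigma> by (intro powr_mono2) (auto simp: le_divide_eq mult.commute)
        also have "\<dots> = e i powr \<sigma> / \<rho> powr \<sigma>" using e(1)[OF i] \<rho> by (simp add: powr_divide)
        finally show ?thesis by (rule mult_left_mono) (use N[of m] in simp)
      qed
      finally show ?thesis .
    qed
  qed
  also have "\<dots> = N m * ((\<Sum>i\<in>I. e i powr \<sigma>) / \<rho> powr \<sigma>)"
    by (simp add: sum_distrib_left sum_divide_distrib)
  finally have "N m * 1 \<le> N m * ((\<Sum>i\<in>I. e i powr \<sigma>) / \<rho> powr \<sigma>)" by simp
  then have "1 \<le> (\<Sum>i\<in>I. e i powr \<sigma>) / \<rho> powr \<sigma>" using N[of m] by (simp only: mult_le_cancel_left_pos)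
  then show ?thesis using \<rho> by (simp add: le_divide_eq)
qed

text \<open>An arbitrary countable cover is enlarged to an open one at the cost of a convergent series, and compactness
leaves finitely many sets.\<close>

lemma hausdorff_pre_measure_limit_set: "0 < hausdorff_pre_measure \<sigma> 1 limit_set"
proof -
  \<comment> \<open>The factor 4 beats the cover sum \<open>h\<close> plus the total error \<open>2 * h\<close>.\<close>
  define h where "h = \<rho> powr \<sigma> / 4"
  have h: "h > 0" using \<rho> by (simp add: h_def)
  have "ennreal h \<le> hausdorff_pre_measure \<sigma> 1 limit_set"
    unfolding hausdorff_pre_measure_def
  proof (rule Inf_greatest, clarify)
    fix U :: "nat \<Rightarrow> 'a set"
    assume cover: "limit_set \<subseteq> (\<Union>i. U i)" and bdd: "\<forall>i. bounded (U i) \<and> diameter (U i) \<le> 1"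
    have dp: "diam_pow \<sigma> (U i) = ennreal (diameter (U i) powr \<sigma>)" for i
      using \<sigma> by (simp add: diam_pow_def)
    show "ennreal h \<le> (\<Sum>i. diam_pow \<sigma> (U i))"
    proof (rule ccontr)
      assume "\<not> ?thesis"
      then have small: "(\<Sum>i. diam_pow \<sigma> (U i)) < ennreal h" by simp
      define d where "d i = diameter (U i)" for i
      have d: "d i \<ge> 0" for i using bdd by (simp add: d_def diameter_ge_0)
      \<comment> \<open>The enlarged size \<open>e i\<close> is chosen so that \<open>e i powr \<sigma>\<close> exceeds \<open>d i powr \<sigma>\<close> by the \<open>i\<close>-th error term.\<close>
      define t where "t i = d i powr \<sigma> + h * (1/2) ^ i" for i :: nat
      define e where "e i = t i powr (1 / \<sigma>)" for i
      have t: "t i > 0" for i using h by (simp add: t_def add_nonneg_pos)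
      have e_powr: "e i powr \<sigma> = t i" for i using t[of i] \<sigma> by (simp add: e_def powr_powr less_imp_le)
      have e0: "e i > 0" for i using t[of i] by (simp add: e_def)
      have de: "d i < e i" for i
      proof (rule ccontr)
        assume "\<not> d i < e i"
        then have "e i powr \<sigma> \<le> d i powr \<sigma>" using e0[of i] \<sigma> by (intro powr_mono2) auto
        moreover have "h * (1/2) ^ i > 0" using h by simp
        ultimately show False by (simp add: e_powr t_def del: power_one_over)
      qed
      define V where "V i = (\<Union>x\<in>U i. ball x ((e i - d i) / 2))" for i
      have "limit_set \<subseteq> (\<Union>i. V i)"
      proof
        fix x assume "x \<in> limit_set"
        then obtain i where "x \<in> U i" using cover by auto
        then have "x \<in> V i" using de[of i] by (auto simp: V_def intro!: bexI[of _ x])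
        then show "x \<in> (\<Union>i. V i)" by auto
      qed
      moreover have "open (V i)" for i by (auto simp: V_def)
      ultimately obtain I where I: "finite I" "limit_set \<subseteq> (\<Union>i\<in>I. V i)"
        using compactE_image[OF compact_limit_set, of UNIV V] by (metis subset_UNIV)
      have close: "dist x y \<le> e i" if xy: "x \<in> V i" "y \<in> V i" for i x y
      proof -
        obtain x' where x': "x' \<in> U i" "dist x' x < (e i - d i) / 2" using xy by (auto simp: V_def)
        obtain y' where y': "y' \<in> U i" "dist y' y < (e i - d i) / 2" using xy by (auto simp: V_def)
        have "dist x' y' \<le> d i" unfolding d_def using bdd x' y' by (intro diameter_bounded_bound) auto
        then show ?thesis
          using x' y' dist_triangle[of x y x'] dist_triangle[of x' y y'] by (simp add: dist_commute)
      qed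
      have "\<rho> powr \<sigma> \<le> (\<Sum>i\<in>I. e i powr \<sigma>)"
        using I e0 close \<open>\<And>i. open (V i)\<close> by (intro cover_sum_lower_bound[of I V]) auto
      also have "\<dots> = (\<Sum>i\<in>I. d i powr \<sigma>) + h * (\<Sum>i\<in>I. (1/2) ^ i)"
        by (simp add: e_powr t_def sum.distrib sum_distrib_left)
      also have "(\<Sum>i\<in>I. (1/2) ^ i) \<le> (2::real)"
      proof -
        have "(\<Sum>i\<in>I. (1/2) ^ i) \<le> (\<Sum>i. (1/2::real) ^ i)"
          using I(1) by (intro sum_le_suminf summable_geometric) auto
        then show ?thesis by (simp add: suminf_geometric)
      qed
      also have "(\<Sum>i\<in>I. d i powr \<sigma>) \<le> h"
      proof -
        have "ennreal (\<Sum>i\<in>I. d i powr \<sigma>) = (\<Sum>i\<in>I. diam_pow \<sigma> (U i))"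
          by (simp add: dp d_def sum_ennreal)
        also have "\<dots> \<le> (\<Sum>i. diam_pow \<sigma> (U i))" using I(1) by (intro sum_le_suminf) auto
        finally have "ennreal (\<Sum>i\<in>I. d i powr \<sigma>) < ennreal h" using small by (rule le_less_trans)
        then show ?thesis by (simp add: ennreal_less_iff sum_nonneg)
      qed
      finally have "\<rho> powr \<sigma> \<le> h + h * 2" using h by simp
      then show False using h by (simp add: h_def)
    qed
  qed
  then show ?thesis using h by (metis ennreal_eq_0_iff le_zero_eq not_gr_zero not_le)
qed

end

lemma hausdorff_pre_measure_mono_exponent:
  assumes "0 \<le> s" "s \<le> \<sigma>" "0 < \<sigma>"
  shows "hausdorff_pre_measure \<sigma> 1 E \<le> hausdorff_pre_measure s 1 E"
  unfolding hausdorff_pre_measure_def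
proof (rule Inf_mono, clarify)
  fix U :: "nat \<Rightarrow> 'a set"
  assume cover: "E \<subseteq> (\<Union>i. U i)" and bdd: "\<forall>i. bounded (U i) \<and> diameter (U i) \<le> 1"
  have "diam_pow \<sigma> (U i) \<le> diam_pow s (U i)" for i
  proof (cases "s = 0")
    case True
    then show ?thesis using assms bdd diameter_ge_0[of "U i"] powr_mono2[of \<sigma> "diameter (U i)" 1]
      by (auto simp: diam_pow_def simp flip: ennreal_1 intro!: ennreal_leI)
  next
    case False
    have "diameter (U i) powr \<sigma> \<le> diameter (U i) powr s"
    proof (cases "diameter (U i) = 0")
      case False
      then have "0 < diameter (U i)" using bdd diameter_ge_0[of "U i"] by simp
      then show ?thesis using assms bdd by (intro powr_mono') auto
    qed simp
    then show ?thesis using False assms by (simp add: diam_pow_def ennreal_leI)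
  qed
  then show "\<exists>a\<in>{\<Sum>i. diam_pow \<sigma> (U i) |U. E \<subseteq> (\<Union>i. U i) \<and> (\<forall>i. bounded (U i) \<and> diameter (U i) \<le> 1)}.
      a \<le> (\<Sum>i. diam_pow s (U i))"
    using cover bdd by (intro bexI[of _ "\<Sum>i. diam_pow \<sigma> (U i)"]) (auto intro!: suminf_le)
qed

text \<open>A positive content at one scale suffices: for diameters at most 1 the sums only grow when the exponent decreases.\<close>

lemma hausdorff_dim_ge:
  assumes "0 < \<sigma>" "0 < hausdorff_pre_measure \<sigma> 1 E"
  shows "ereal \<sigma> \<le> hausdorff_dim E"
  unfolding hausdorff_dim_def
proof (rule Inf_greatest, clarify)
  fix s :: real assume s: "0 \<le> s" "hausdorff_measure s E = 0"
  show "ereal \<sigma> \<le> ereal s"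
  proof (rule ccontr)
    assume "\<not> ?thesis"
    then have "s \<le> \<sigma>" by simp
    have "0 < hausdorff_pre_measure s 1 E"
      using assms(2) hausdorff_pre_measure_mono_exponent[OF s(1) \<open>s \<le> \<sigma>\<close> assms(1)] by (rule less_le_trans)
    also have "\<dots> \<le> hausdorff_measure s E" unfolding hausdorff_measure_def by (intro SUP_upper) auto
    finally show False using s(2) by simp
  qed
qed

section \<open>Lipschitz graphs from maps with a common linear part\<close>

text \<open>A set on which the projection to a line has an inverse with Lipschitz constant \<open>L\<close> is the graph over
that line of the orthogonal coordinate.\<close>

lemma lipschitz_graph_of_projection:
  fixes S :: "(real^2) set" and e :: "real^2"
  assumes e: "norm e = 1" and L: "0 \<le> L" and proj: "\<And>x y. x \<in> S \<Longrightarrow> y \<in> S \<Longrightarrow> dist x y \<le> L * \<bar>e \<bullet> (x - y)\<bar>"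
  shows "\<exists>\<theta> A g. lipschitz_graph \<theta> A g S \<and> Lip A g \<le> L"
proof -
  have "(e$1)\<^sup>2 + (e$2)\<^sup>2 = 1"
    using e by (simp add: norm_eq_1 inner_real2 power2_eq_square)
  then obtain \<theta> where \<theta>: "e$1 = cos \<theta>" "e$2 = sin \<theta>" using sincos_total_2pi by metis
  define u :: "real^2" where "u = vector [- sin \<theta>, cos \<theta>]"
  have e_eq: "e = vector [cos \<theta>, sin \<theta>]" using \<theta> by (simp add: vec_eq_iff forall_2)
  have u: "norm u = 1" using sin_cos_squared_add[of \<theta>] by (simp add: norm_eq_1 inner_real2 u_def power2_eq_square)
  have decomp: "(e \<bullet> x) *\<^sub>R e + (u \<bullet> x) *\<^sub>R u = x" for x
  proof -
    have "cos \<theta> * cos \<theta> + sin \<theta> * sin \<theta> = 1" using sin_cos_squared_add2[of \<theta>] by (simp add: power2_eq_square)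
    then have "(cos \<theta> * x$1 + sin \<theta> * x$2) * cos \<theta> + (- sin \<theta> * x$1 + cos \<theta> * x$2) * - sin \<theta> = x$1"
      "(cos \<theta> * x$1 + sin \<theta> * x$2) * sin \<theta> + (- sin \<theta> * x$1 + cos \<theta> * x$2) * cos \<theta> = x$2"
      by algebra+
    then show ?thesis by (simp add: vec_eq_iff forall_2 inner_real2 \<theta> u_def)
  qed
  define A where "A = (\<lambda>x. e \<bullet> x) ` S"
  define pt where "pt t = (SOME x. x \<in> S \<and> e \<bullet> x = t)" for t
  define g where "g t = u \<bullet> pt t" for t
  have pt: "pt t \<in> S" "e \<bullet> pt t = t" if "t \<in> A" for t
  proof -
    have "\<exists>x. x \<in> S \<and> e \<bullet> x = t" using that by (auto simp: A_def)
    then have "pt t \<in> S \<and> e \<bullet> pt t = t" unfolding pt_def by (rule someI_ex)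
    then show "pt t \<in> S" "e \<bullet> pt t = t" by auto
  qed
  have pt_proj: "pt (e \<bullet> x) = x" if "x \<in> S" for x
  proof -
    have "e \<bullet> x \<in> A" using that by (simp add: A_def)
    then have "dist (pt (e \<bullet> x)) x \<le> L * \<bar>e \<bullet> (pt (e \<bullet> x) - x)\<bar>" "e \<bullet> pt (e \<bullet> x) = e \<bullet> x"
      using pt that by (auto intro!: proj)
    then show ?thesis by (simp add: inner_diff_right)
  qed
  have lip: "L-lipschitz_on A g"
  proof (rule lipschitz_onI)
    fix t t' assume t: "t \<in> A" "t' \<in> A"
    have "dist (g t) (g t') = \<bar>u \<bullet> (pt t - pt t')\<bar>" by (simp add: g_def dist_real_def inner_diff_right)
    also have "\<dots> \<le> norm u * norm (pt t - pt t')" by (rule Cauchy_Schwarz_ineq2)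
    also have "\<dots> = dist (pt t) (pt t')" using u by (simp add: dist_norm)
    also have "\<dots> \<le> L * \<bar>e \<bullet> (pt t - pt t')\<bar>" using t pt by (intro proj)
    also have "\<dots> = L * dist t t'" using t pt by (simp add: inner_diff_right dist_real_def)
    finally show "dist (g t) (g t') \<le> L * dist t t'" .
  qed (rule L)
  have "S = graph_over \<theta> A g"
  proof -
    have pteq: "t *\<^sub>R e + g t *\<^sub>R u = pt t" if "t \<in> A" for t
      using decomp[of "pt t"] pt[OF that] by (simp add: g_def)
    have "graph_over \<theta> A g = (\<lambda>t. t *\<^sub>R e + g t *\<^sub>R u) ` A"
      by (auto simp: graph_over_def e_eq[symmetric] u_def[symmetric])
    also have "\<dots> = pt ` A" using pteq by (intro image_cong) auto
    also have "\<dots> = S" using pt_proj by (force simp: A_def image_image)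
    finally show ?thesis by simp
  qed
  then have "lipschitz_graph \<theta> A g S" using lip by (auto simp: lipschitz_graph_def)
  moreover have "Lip A g \<le> L"
    unfolding Lip_def using lip by (intro cInf_lower) (auto intro!: bdd_belowI[of _ 0] dest: lipschitz_on_nonneg)
  ultimately show ?thesis by blast
qed

text \<open>All maps of the family have the same ratio \<open>\<rho>\<close> and the same rotation \<open>R\<close>, so the linear part of a
composition depends only on its length.\<close>

locale homothetic_family =
  fixes T :: "'w set" and F :: "'w \<Rightarrow> real^2 \<Rightarrow> real^2" and R :: "real^2^2" and C :: "(real^2) set"
    and a :: "real^2" and \<rho> D :: real
  assumes finite_T: "finite T" and similar: "w \<in> T \<Longrightarrow> F w x - F w y = \<rho> *\<^sub>R (R *v (x - y))"
    and R: "orthogonal_matrix R" and \<rho>: "0 < \<rho>" "\<rho> < 1"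
    and C: "compact C" "C \<noteq> {}" and inv: "w \<in> T \<Longrightarrow> F w ` C \<subseteq> C"
    and near: "x \<in> C \<Longrightarrow> dist a x \<le> D" and D: "1 \<le> D"
begin

text \<open>Since \<open>e \<bullet> (R *v x) = turn e \<bullet> x\<close>, projecting a piece of first level in direction \<open>e\<close>
is, up to scale, projecting the whole set in direction \<open>turn e\<close>.\<close>

definition turn :: "real^2 \<Rightarrow> real^2" where "turn e = transpose R *v e"

lemma norm_R: "norm (R *v x) = norm x"
  using norm_orthogonal_transpose[of "transpose R" x] R by (simp add: orthogonal_matrix_transpose)

lemma norm_turn: "norm (turn e) = norm e"
  unfolding turn_def using R by (rule norm_orthogonal_transpose)

lemma inner_similar: "w \<in> T \<Longrightarrow> e \<bullet> (F w x - F w y) = \<rho> * (turn e \<bullet> (x - y))"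
  using orthogonal_matrix_inner[of "transpose R" e "x - y"] by (simp add: similar turn_def)

lemma dist_similar: "w \<in> T \<Longrightarrow> dist (F w x) (F w y) = \<rho> * dist x y"
  using \<rho> by (simp add: dist_norm similar norm_R)

definition piece :: "'w list \<Rightarrow> (real^2) set" where "piece ws = foldr F ws ` C"

lemma piece_Nil [simp]: "piece [] = C" by (simp add: piece_def)

lemma piece_Cons: "piece (w # ws) = F w ` piece ws"
  by (simp add: piece_def image_image)

lemma piece_subset: "set ws \<subseteq> T \<Longrightarrow> piece ws \<subseteq> C"
proof (induction ws)
  case (Cons w ws)
  then have "F w ` piece ws \<subseteq> F w ` C" by (intro image_mono) auto
  then show ?case using inv[of w] Cons.prems by (auto simp: piece_Cons)
qed simp

lemma piece_compact: "set ws \<subseteq> T \<Longrightarrow> compact (piece ws) \<and> piece ws \<noteq> {}"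
proof (induction ws)
  case (Cons w ws)
  have "\<rho>-lipschitz_on (piece ws) (F w)"
    using Cons.prems \<rho> dist_similar by (intro lipschitz_onI) auto
  then have "continuous_on (piece ws) (F w)" by (rule lipschitz_on_continuous_on)
  then show ?case using Cons by (simp add: piece_Cons compact_continuous_image)
qed (use C in simp)

lemma piece_snoc: "w \<in> T \<Longrightarrow> piece (ws @ [w]) \<subseteq> piece ws"
  using inv[of w] by (auto simp: piece_def)

lemma piece_diameter: "set ws \<subseteq> T \<Longrightarrow> x \<in> piece ws \<Longrightarrow> y \<in> piece ws \<Longrightarrow> dist x y \<le> 2 * D * \<rho> ^ length ws"
proof (induction ws arbitrary: x y)
  case Nil
  then show ?case using near[of x] near[of y] dist_triangle2[of x y a] by (simp add: dist_commute)
next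
  case (Cons w ws)
  then obtain x' y' where xy: "x = F w x'" "y = F w y'" "x' \<in> piece ws" "y' \<in> piece ws"
    by (auto simp: piece_Cons)
  have "\<rho> * dist x' y' \<le> \<rho> * (2 * D * \<rho> ^ length ws)"
    using Cons xy \<rho> by (intro mult_left_mono) auto
  then show ?case using xy Cons.prems dist_similar[of w x' y'] by (simp add: mult_ac)
qed

lemma branches_set: "(\<And>i. W i \<subseteq> T) \<Longrightarrow> ws \<in> branches W k \<Longrightarrow> set ws \<subseteq> T"
  by (auto simp: branches_def in_set_conv_nth subset_iff)

text \<open>Descending one level replaces the direction \<open>e\<close> by \<open>turn e\<close> and scales by \<open>\<rho>\<close>, so two branches that
first differ at level \<open>i\<close> are compared at scale \<open>\<rho> ^ i\<close> in direction \<open>(turn ^^ i) e\<close>, which is the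
direction in which \<open>W i\<close> was chosen. A piece stays within \<open>D * \<rho>\<close> of the image of \<open>a\<close> and \<open>e\<close>
has norm at most 2, so half of the separation \<open>8 * D * \<rho>\<close> of these images is left for the pieces.\<close>

lemma projection_gap:
  assumes "\<And>i. W i \<subseteq> T" "\<And>i. separated (8 * D * \<rho>) (\<lambda>w. (turn ^^ i) e \<bullet> F w a) (W i)" "norm e \<le> 2"
    and "ws \<in> branches W k" "vs \<in> branches W k" "ws \<noteq> vs" "x \<in> piece ws" "y \<in> piece vs"
  shows "4 * D * \<rho> ^ k \<le> \<bar>e \<bullet> (x - y)\<bar>"
  using assms
proof (induction k arbitrary: W e ws vs x y)
  case (Suc k)
  obtain w ws' where ws: "ws = w # ws'" using Suc.prems(4) by (cases ws) (auto simp: branches_def)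
  obtain v vs' where vs: "vs = v # vs'" using Suc.prems(5) by (cases vs) (auto simp: branches_def)
  have wv: "w \<in> W 0" "v \<in> W 0" "ws' \<in> branches (\<lambda>i. W (Suc i)) k" "vs' \<in> branches (\<lambda>i. W (Suc i)) k"
    using Suc.prems(4,5) by (simp_all add: ws vs branches_Cons)
  have wvT: "w \<in> T" "v \<in> T" using wv Suc.prems(1) by auto
  obtain x' where x: "x = F w x'" "x' \<in> piece ws'" using Suc.prems(7) by (auto simp: ws piece_Cons)
  obtain y' where y: "y = F v y'" "y' \<in> piece vs'" using Suc.prems(8) by (auto simp: vs piece_Cons)
  have "set ws' \<subseteq> T" "set vs' \<subseteq> T"
    using wv branches_set[of "\<lambda>i. W (Suc i)"] Suc.prems(1) by blast+
  then have C: "x' \<in> C" "y' \<in> C" using x y piece_subset by blast+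
  show ?case
  proof (cases "w = v")
    case True
    have "4 * D * \<rho> ^ k \<le> \<bar>turn e \<bullet> (x' - y')\<bar>"
    proof (rule Suc.IH)
      show "separated (8 * D * \<rho>) (\<lambda>w. (turn ^^ i) (turn e) \<bullet> F w a) (W (Suc i))" for i
        using Suc.prems(2)[of "Suc i"] by (simp only: funpow_Suc_right comp_apply)
      show "norm (turn e) \<le> 2" using Suc.prems(3) by (simp add: norm_turn)
      show "ws' \<noteq> vs'" using Suc.prems(6) True by (simp add: ws vs)
    qed (use Suc.prems(1) wv x y in auto)
    then have "\<rho> * (4 * D * \<rho> ^ k) \<le> \<rho> * \<bar>turn e \<bullet> (x' - y')\<bar>" using \<rho> by (intro mult_left_mono) auto
    also have "\<dots> = \<bar>e \<bullet> (x - y)\<bar>"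
      using inner_similar[of w e x' y'] wvT \<rho> by (simp add: x y True abs_mult)
    finally show ?thesis by (simp add: mult_ac)
  next
    case False
    have close: "\<bar>e \<bullet> (F u z - F u a)\<bar> \<le> 2 * D * \<rho>" if "u \<in> T" "z \<in> C" for u z
    proof -
      have "\<bar>e \<bullet> (F u z - F u a)\<bar> \<le> norm e * dist (F u z) (F u a)"
        unfolding dist_norm by (rule Cauchy_Schwarz_ineq2)
      also have "dist (F u z) (F u a) = \<rho> * dist a z" using that by (simp add: dist_similar dist_commute)
      also have "norm e * (\<rho> * dist a z) \<le> 2 * (\<rho> * D)"
        using Suc.prems(3) near[OF that(2)] \<rho> by (intro mult_mono) auto
      finally show ?thesis by (simp add: mult_ac)
    qed
    have "8 * D * \<rho> \<le> \<bar>e \<bullet> F w a - e \<bullet> F v a\<bar>"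
      using Suc.prems(2)[of 0] wv(1,2) False by (auto simp: separated_def)
    moreover have "e \<bullet> (x - y) = e \<bullet> (F w x' - F w a) - e \<bullet> (F v y' - F v a) + (e \<bullet> F w a - e \<bullet> F v a)"
      by (simp add: x y inner_diff_right)
    ultimately have "4 * D * \<rho> \<le> \<bar>e \<bullet> (x - y)\<bar>"
      using close[OF wvT(1) C(1)] close[OF wvT(2) C(2)] by linarith
    moreover have "D * \<rho> ^ Suc k \<le> D * \<rho>"
      using D \<rho> mult_left_mono[of "\<rho> ^ k" 1 "D * \<rho>"] power_le_one[of \<rho> k] by (simp add: mult_ac)
    ultimately show ?thesis by linarith
  qed
qed simp

text \<open>At level \<open>i\<close> keep a largest separated family for the direction \<open>(turn ^^ i) e\<close>. The limit set then has
dimension at least \<open>\<sigma>\<close>. Two of its points that part ways at level \<open>k + 1\<close> have distance at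
most \<open>2 * D * \<rho> ^ k\<close>, while their projections differ by at least \<open>4 * D * \<rho> ^ (k + 1)\<close>: losing one
level costs one factor \<open>1 / \<rho>\<close>, and that is the Lipschitz constant.\<close>

lemma lipschitz_graph_from_direction:
  assumes e: "1 \<le> norm e" "norm e \<le> 2" and \<sigma>: "0 < \<sigma>" and T: "T \<noteq> {}"
    and growth: "\<And>k. (1 / \<rho> ^ k) powr \<sigma> \<le> (\<Prod>i<k. real (packing_number (8 * D * \<rho>) (\<lambda>w. (turn ^^ i) e \<bullet> F w a) T))"
  shows "\<exists>\<Gamma> \<theta> A g. \<Gamma> \<subseteq> C \<and> lipschitz_graph \<theta> A g \<Gamma> \<and> ereal \<sigma> \<le> hausdorff_dim \<Gamma> \<and> Lip A g \<le> 1 / \<rho>"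
proof -
  have "\<exists>V. V \<subseteq> T \<and> separated (8 * D * \<rho>) (\<lambda>w. (turn ^^ i) e \<bullet> F w a) V
      \<and> card V = packing_number (8 * D * \<rho>) (\<lambda>w. (turn ^^ i) e \<bullet> F w a) T" for i
    using packing_number_witness[OF finite_T] by metis
  then obtain W where W: "\<And>i. W i \<subseteq> T" "\<And>i. separated (8 * D * \<rho>) (\<lambda>w. (turn ^^ i) e \<bullet> F w a) (W i)"
    "\<And>i. card (W i) = packing_number (8 * D * \<rho>) (\<lambda>w. (turn ^^ i) e \<bullet> F w a) T" by metis
  have setT: "set ws \<subseteq> T" if "ws \<in> branches W k" for ws k using branches_set[of W] W(1) that by blast
  note pgap = projection_gap[of W e, OF W(1,2) e(2)]
  interpret M: moran_construction W piece \<rho> \<sigma>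
  proof
    show "finite (W i)" for i using W(1) finite_T by (rule finite_subset)
    show "W i \<noteq> {}" for i
      using packing_number_pos[OF finite_T T, of "8 * D * \<rho>" "\<lambda>w. (turn ^^ i) e \<bullet> F w a"] W(3)[of i] by auto
    show "compact (piece ws) \<and> piece ws \<noteq> {}" if "ws \<in> branches W k" for ws k
      using setT[OF that] by (rule piece_compact)
    show "piece (ws @ [w]) \<subseteq> piece ws" if "ws \<in> branches W k" "w \<in> W k" for ws w k
      using W(1) that by (intro piece_snoc) auto
    show "\<rho> ^ k \<le> dist x y"
      if "ws \<in> branches W k" "vs \<in> branches W k" "ws \<noteq> vs" "x \<in> piece ws" "y \<in> piece vs" for ws vs k x y
    proof -
      have "4 * 1 * \<rho> ^ k \<le> 4 * D * \<rho> ^ k" using D \<rho> by (intro mult_right_mono) auto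
      also have "\<dots> \<le> \<bar>e \<bullet> (x - y)\<bar>" using that by (rule pgap)
      also have "\<dots> \<le> norm e * dist x y" unfolding dist_norm by (rule Cauchy_Schwarz_ineq2)
      also have "\<dots> \<le> 2 * dist x y" using e by (intro mult_right_mono) auto
      finally show ?thesis using \<rho> zero_le_power[of \<rho> k] by linarith
    qed
    show "(1 / \<rho> ^ k) powr \<sigma> \<le> (\<Prod>i<k. real (card (W i)))" for k using growth[of k] by (simp add: W(3))
  qed (use \<rho> \<sigma> in auto)
  let ?S = M.limit_set
  have SC: "?S \<subseteq> C"
    unfolding M.limit_set_def M.level_def by (auto dest!: spec[of _ 0])
  have proj: "dist x y \<le> 1 / \<rho> * \<bar>((1 / norm e) *\<^sub>R e) \<bullet> (x - y)\<bar>" if xy: "x \<in> ?S" "y \<in> ?S" for x y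
  proof (cases "x = y")
    case False
    define same where "same k \<longleftrightarrow> (\<exists>ws\<in>branches W k. x \<in> piece ws \<and> y \<in> piece ws)" for k
    have "\<exists>k. \<not> same k"
    proof (rule ccontr)
      assume "\<nexists>k. \<not> same k"
      have small: "dist x y \<le> 2 * D * \<rho> ^ k" for k
      proof -
        obtain us where us: "us \<in> branches W k" "x \<in> piece us" "y \<in> piece us"
          using \<open>\<nexists>k. \<not> same k\<close> by (auto simp: same_def)
        moreover have "length us = k" using us(1) by (simp add: branches_def)
        ultimately show ?thesis using piece_diameter[OF setT[OF us(1)] us(2,3)] by simp
      qed
      obtain k where "\<rho> ^ k < dist x y / (2 * D)"
        using real_arch_pow_inv[of "dist x y / (2 * D)" \<rho>] \<rho> D False by auto
      then show False using small[of k] D by (simp add: less_divide_eq mult_ac)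
    qed
    moreover have "same 0" using xy SC by (auto simp: same_def)
    ultimately obtain k where k: "same k" "\<not> same (Suc k)" by (metis nat_induct)
    obtain us where us: "us \<in> branches W k" "x \<in> piece us" "y \<in> piece us" using k(1) by (auto simp: same_def)
    have "x \<in> M.level (Suc k)" "y \<in> M.level (Suc k)" using xy by (auto simp: M.limit_set_def)
    then obtain ws vs where wv: "ws \<in> branches W (Suc k)" "vs \<in> branches W (Suc k)" "x \<in> piece ws" "y \<in> piece vs"
      by (auto simp: M.level_def)
    then have "ws \<noteq> vs" using k(2) by (auto simp: same_def)
    then have gap: "4 * D * \<rho> ^ Suc k \<le> \<bar>e \<bullet> (x - y)\<bar>" using wv by (intro pgap)
    have "length us = k" using us(1) by (simp add: branches_def)
    then have "\<rho> * dist x y \<le> \<rho> * (2 * D * \<rho> ^ k)"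
      using piece_diameter[OF setT[OF us(1)] us(2,3)] \<rho> by (intro mult_left_mono) auto
    also have "\<dots> \<le> \<bar>e \<bullet> (x - y)\<bar> / 2" using gap by (simp add: mult_ac)
    also have "\<dots> \<le> \<bar>e \<bullet> (x - y)\<bar> / norm e" using e by (intro divide_left_mono) auto
    also have "\<dots> = \<bar>((1 / norm e) *\<^sub>R e) \<bullet> (x - y)\<bar>" using e by (simp add: abs_mult)
    finally have "dist x y \<le> \<bar>((1 / norm e) *\<^sub>R e) \<bullet> (x - y)\<bar> / \<rho>"
      by (simp only: pos_le_divide_eq[OF \<rho>(1)] mult.commute)
    then show ?thesis by (simp only: times_divide_eq_left mult_1_left)
  qed simp
  have "e \<noteq> 0" using e by auto
  then have "norm ((1 / norm e) *\<^sub>R e) = 1" by simp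
  then obtain \<theta> A g where "lipschitz_graph \<theta> A g ?S" "Lip A g \<le> 1 / \<rho>"
    using lipschitz_graph_of_projection[of "(1 / norm e) *\<^sub>R e" "1 / \<rho>" ?S] proj \<rho> by auto
  moreover have "ereal \<sigma> \<le> hausdorff_dim ?S"
    using \<sigma> M.hausdorff_pre_measure_limit_set by (rule hausdorff_dim_ge)
  ultimately show ?thesis using SC by blast
qed

end

context homothetic_family
begin

text \<open>The averages over directions are available for any orthogonal matrix, hence along the whole orbit of \<open>turn\<close>.\<close>

lemma turn_pow_matrix: "\<exists>Q. orthogonal_matrix Q \<and> (\<forall>x. (turn ^^ i) x = Q *v x)"
proof (induction i)
  case 0
  have "orthogonal_matrix (mat 1 :: real^2^2)" by (rule orthogonal_matrix_id)
  then show ?case by (intro exI[of _ "mat 1"]) simp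
next
  case (Suc i)
  then obtain Q where Q: "orthogonal_matrix Q" "\<And>x. (turn ^^ i) x = Q *v x" by auto
  have "orthogonal_matrix (transpose R ** Q)"
    using Q(1) R orthogonal_matrix_transpose[of R] by (intro orthogonal_matrix_mul) auto
  moreover have "(turn ^^ Suc i) x = (transpose R ** Q) *v x" for x
    by (simp only: funpow.simps comp_apply Q(2) turn_def matrix_vector_mul_assoc)
  ultimately show ?case by blast
qed

text \<open>For every level the logarithm of the packing number is large on average over a fixed finite sample of directions, so some
direction of the sample has a large sum over a block of levels. The orbit of a good direction then makes the product of
packing numbers large at all levels. The summand 1 in the last hypothesis pays for the loss in the choice of this orbit.\<close>

lemma lipschitz_graph_from_energy:
  assumes T: "T \<noteq> {}"
    and distinct: "\<And>v w. v \<in> T \<Longrightarrow> w \<in> T \<Longrightarrow> v \<noteq> w \<Longrightarrow> F v a \<noteq> F w a \<and> dist (F v a) (F w a) \<le> 4 * D"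
    and energy: "\<And>v. v \<in> T \<Longrightarrow> (\<Sum>w\<in>T - {v}. 1 / dist (F v a) (F w a)) \<le> E"
    and \<sigma>: "0 < \<sigma>" "\<sigma> * ln (1 / \<rho>) + 1 \<le> ln (real (card T) / (2 * (1 + 52 * D * \<rho> * E)))"
  shows "\<exists>\<Gamma> \<theta> A g. \<Gamma> \<subseteq> C \<and> lipschitz_graph \<theta> A g \<Gamma> \<and> ereal \<sigma> \<le> hausdorff_dim \<Gamma> \<and> Lip A g \<le> 1 / \<rho>"
proof -
  define \<eta> where "\<eta> = 8 * D * \<rho>"
  have \<eta>: "\<eta> > 0" using D \<rho> by (simp add: \<eta>_def)
  define N where "N e = packing_number \<eta> (\<lambda>w. e \<bullet> F w a) T" for e
  have N1: "1 \<le> N e" for e unfolding N_def using finite_T T by (rule packing_number_pos)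
  define c where "c = ln (real (card T) / (2 * (1 + (6 * \<eta> + 4 * D * \<rho>) * E)))"
  have c: "\<sigma> * ln (1 / \<rho>) + 1 \<le> c" using \<sigma>(2) by (simp add: c_def \<eta>_def)
  define K where "K = {e::real^2. 1 \<le> norm e \<and> norm e \<le> 2}"
  have "\<exists>e\<in>K. \<forall>k. real k * (c - 1) \<le> (\<Sum>i<k. ln (real (N ((turn ^^ i) e))))"
  proof (rule good_orbit_exists)
    have "K = cball 0 2 - ball 0 1" by (auto simp: K_def)
    then show "compact K" by (simp add: compact_diff)
    show "continuous_on UNIV turn"
      unfolding turn_def by (intro linear_continuous_on matrix_vector_mul_bounded_linear)
    show "turn ` K \<subseteq> K" by (auto simp: K_def norm_turn)
    show "\<forall>\<^sub>F y in nhds x. ln (real (N y)) \<le> ln (real (N x))" for x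
      using packing_number_upper_semicontinuous[OF finite_T, of \<eta> "\<lambda>w. F w a" x]
    proof eventually_elim
      case (elim y)
      then show ?case using N1[of y] by (intro ln_mono) (auto simp: N_def)
    qed
    show "ln (real (N x)) \<le> ln (real (card T))" for x
      using N1[of x] packing_number_le_card[OF finite_T, of \<eta> "\<lambda>w. x \<bullet> F w a"] by (intro ln_mono) (auto simp: N_def)
    show "\<exists>x\<in>K. real n * c \<le> (\<Sum>i<n. ln (real (N ((turn ^^ i) x))))" for n
    proof -
      \<comment> \<open>The sample is fine enough to resolve directions up to \<open>\<rho>\<close>.\<close>
      obtain L :: nat where L: "1 / \<rho> < real L" using reals_Archimedean2 by blast
      have L0: "L > 0"
      proof (rule ccontr)
        assume "\<not> 0 < L"
        then show False using L \<rho> by (simp add: divide_less_0_iff)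
      qed
      have L\<rho>: "1 \<le> \<rho> * real L" using L \<rho> by (simp add: divide_less_eq mult.commute)
      have avg: "real L * c \<le> (\<Sum>l<L. ln (real (N ((turn ^^ i) (slope_dir L l)))))" for i
      proof -
        obtain Q where Q: "orthogonal_matrix Q" "\<And>x. (turn ^^ i) x = Q *v x" using turn_pow_matrix by blast
        show ?thesis
          unfolding c_def N_def Q(2)
          using energy distinct D by (intro average_log_packing_number finite_T T \<eta> L0 L\<rho> \<rho>(1) Q(1)) (auto simp: dist_norm)
      qed
      have "\<exists>l<L. real n * c \<le> (\<Sum>i<n. ln (real (N ((turn ^^ i) (slope_dir L l)))))"
      proof (rule ccontr)
        assume "\<not> ?thesis"
        then have "(\<Sum>l<L. \<Sum>i<n. ln (real (N ((turn ^^ i) (slope_dir L l))))) < (\<Sum>l<L. real n * c)"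
          using L0 by (intro sum_strict_mono) (auto simp: not_le)
        moreover have "(\<Sum>i<n. real L * c) \<le> (\<Sum>i<n. \<Sum>l<L. ln (real (N ((turn ^^ i) (slope_dir L l)))))"
          by (intro sum_mono avg)
        ultimately show False by (subst (asm) sum.swap) (simp add: mult_ac)
      qed
      then obtain l where l: "l < L" "real n * c \<le> (\<Sum>i<n. ln (real (N ((turn ^^ i) (slope_dir L l)))))" by blast
      then show ?thesis using slope_dir_norm[OF l(1)] by (intro bexI[of _ "slope_dir L l"]) (auto simp: K_def)
    qed
  qed simp
  then obtain e where e: "e \<in> K" "\<And>k. real k * (c - 1) \<le> (\<Sum>i<k. ln (real (N ((turn ^^ i) e))))" by blast
  show ?thesis
  proof (rule lipschitz_graph_from_direction)
    show "1 \<le> norm e" "norm e \<le> 2" using e(1) by (auto simp: K_def)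
    fix k
    have "real k * (\<sigma> * ln (1 / \<rho>)) \<le> real k * (c - 1)" using c by (intro mult_left_mono) auto
    also note e(2)[of k]
    also have "(\<Sum>i<k. ln (real (N ((turn ^^ i) e)))) = ln (\<Prod>i<k. real (N ((turn ^^ i) e)))"
      using N1 by (intro ln_prod[symmetric]) (auto simp: Suc_le_eq)
    finally have "exp (real k * (\<sigma> * ln (1 / \<rho>))) \<le> exp (ln (\<Prod>i<k. real (N ((turn ^^ i) e))))" by simp
    also have "\<dots> = (\<Prod>i<k. real (N ((turn ^^ i) e)))"
      using N1 by (intro exp_ln prod_pos) (auto simp: Suc_le_eq)
    also have "exp (real k * (\<sigma> * ln (1 / \<rho>))) = (1 / \<rho> ^ k) powr \<sigma>"
      using \<rho> by (simp add: powr_def ln_div ln_realpow algebra_simps)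
    finally show "(1 / \<rho> ^ k) powr \<sigma> \<le> (\<Prod>i<k. real (packing_number (8 * D * \<rho>) (\<lambda>w. (turn ^^ i) e \<bullet> F w a) T))"
      by (simp only: N_def \<eta>_def)
  qed (use \<sigma> T in auto)
qed

end

section \<open>The similarity dimension is at least one\<close>

lemma hausdorff_pre_measure_finite_cover:
  assumes I: "finite I" and cover: "E \<subseteq> (\<Union>i\<in>I. V i)" and \<delta>: "0 \<le> \<delta>"
    and V: "\<And>i. i \<in> I \<Longrightarrow> bounded (V i) \<and> diameter (V i) \<le> \<delta>"
  shows "hausdorff_pre_measure s \<delta> E \<le> (\<Sum>i\<in>I. diam_pow s (V i))"
proof -
  obtain h where h: "bij_betw h {0..<card I} I" using ex_bij_betw_nat_finite[OF I] by auto
  define U where "U k = (if k < card I then V (h k) else {})" for k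
  have hI: "h k \<in> I" if "k < card I" for k using h that by (auto simp: bij_betw_def)
  have "(\<Sum>k. diam_pow s (U k)) = (\<Sum>k\<in>{0..<card I}. diam_pow s (U k))"
    by (rule suminf_finite) (auto simp: U_def diam_pow_def)
  also have "\<dots> = (\<Sum>k\<in>{0..<card I}. diam_pow s (V (h k)))" by (intro sum.cong) (auto simp: U_def)
  also have "\<dots> = (\<Sum>i\<in>I. diam_pow s (V i))" by (rule sum.reindex_bij_betw[OF h])
  finally have sum: "(\<Sum>k. diam_pow s (U k)) = (\<Sum>i\<in>I. diam_pow s (V i))" .
  have "E \<subseteq> (\<Union>k. U k)"
  proof
    fix x assume "x \<in> E"
    then obtain i where i: "i \<in> I" "x \<in> V i" using cover by auto
    have "I = h ` {0..<card I}" using h by (simp add: bij_betw_def)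
    then obtain k where "k < card I" "h k = i" using i(1) by (metis atLeastLessThan_iff imageE)
    then show "x \<in> (\<Union>k. U k)" using i(2) by (auto simp: U_def intro!: exI[of _ k])
  qed
  moreover have "\<forall>k. bounded (U k) \<and> diameter (U k) \<le> \<delta>" using V hI \<delta> by (simp add: U_def)
  ultimately show ?thesis
    unfolding hausdorff_pre_measure_def sum[symmetric] by (intro Inf_lower) blast
qed

context similarity_system
begin

lemma attractor_words:
  assumes "C = (\<Union>j\<in>J. f j ` C)"
  shows "C = (\<Union>w\<in>words J n. foldr f w ` C)"
proof (induction n)
  case 0
  have "words J 0 = {[]}" by auto
  then show ?case by simp
next
  case (Suc n)
  have "(\<Union>w\<in>words J (Suc n). foldr f w ` C) = (\<Union>j\<in>J. f j ` (\<Union>w\<in>words J n. foldr f w ` C))"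
    unfolding lists_length_Suc_eq by (fastforce simp: image_iff)
  then show ?case using Suc.IH assms by metis
qed

text \<open>Cover by the cylinders of length \<open>n\<close>: their diameters decay like \<open>(\<Sum>j\<in>J. r j) ^ n\<close> and the cover sum like
\<open>(\<Sum>j\<in>J. r j powr s) ^ n\<close>.\<close>

lemma hausdorff_measure_attractor_zero:
  assumes C: "compact C" "C = (\<Union>j\<in>J. f j ` C)" and r1: "(\<Sum>j\<in>J. r j) < 1"
    and s: "0 < s" "(\<Sum>j\<in>J. r j powr s) < 1"
  shows "hausdorff_measure s C = 0"
proof -
  define b where "b = (\<Sum>j\<in>J. r j)"
  define t where "t = (\<Sum>j\<in>J. r j powr s)"
  have b: "0 \<le> b" "b < 1" using ratio r1 unfolding b_def by (auto intro: sum_nonneg less_imp_le)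
  have t: "0 \<le> t" "t < 1" using s by (auto simp: t_def intro!: sum_nonneg)
  have bdd: "bounded C" using C(1) by (rule compact_imp_bounded)
  define d where "d = diameter C"
  have d: "0 \<le> d" unfolding d_def using bdd by (rule diameter_ge_0)
  have wdiam: "diameter (foldr f w ` C) \<le> weight r w * d" if "set w \<subseteq> J" for w
  proof (rule diameter_le)
    show "foldr f w ` C \<noteq> {} \<or> 0 \<le> weight r w * d" using weight_r_pos[OF that] d by simp
    fix x y assume "x \<in> foldr f w ` C" "y \<in> foldr f w ` C"
    then obtain x' y' where "x = foldr f w x'" "y = foldr f w y'" "x' \<in> C" "y' \<in> C" by auto
    then show "norm (x - y) \<le> weight r w * d"
      using word_dist[OF that, of x' y'] diameter_bounded_bound[OF bdd, of x' y'] weight_r_pos[OF that]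
      by (simp add: dist_norm d_def)
  qed
  have "hausdorff_pre_measure s \<delta> C = 0" if \<delta>: "\<delta> > 0" for \<delta>
  proof -
    have bound: "hausdorff_pre_measure s \<delta> C \<le> ennreal (d powr s * t ^ n)" if n: "b ^ n * d \<le> \<delta>" for n
    proof -
      have le\<delta>: "bounded (foldr f w ` C) \<and> diameter (foldr f w ` C) \<le> \<delta>" if "w \<in> words J n" for w
      proof -
        have "r j \<le> b" if "j \<in> J" for j
          unfolding b_def using that finite_J ratio by (intro member_le_sum) (auto intro: less_imp_le)
        then have "weight r w \<le> b ^ n" using weight_le_power[of J r b w] ratio that by blast
        then have "weight r w * d \<le> \<delta>" using n d mult_right_mono[of "weight r w" "b ^ n" d] by linarith
        moreover have "compact (foldr f w ` C)"
          using C(1) that word_dist weight_r_pos[of w]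
          by (intro compact_continuous_image lipschitz_on_continuous_on[of "weight r w"] lipschitz_onI) auto
        ultimately show ?thesis using wdiam[of w] that by (auto intro: compact_imp_bounded)
      qed
      have "hausdorff_pre_measure s \<delta> C \<le> (\<Sum>w\<in>words J n. diam_pow s (foldr f w ` C))"
        using attractor_words[OF C(2), of n] \<delta> le\<delta>
        by (intro hausdorff_pre_measure_finite_cover finite_words finite_J) auto
      also have "\<dots> \<le> (\<Sum>w\<in>words J n. ennreal (d powr s * weight (\<lambda>j. r j powr s) w))"
      proof (rule sum_mono)
        fix w assume w: "w \<in> words J n"
        have "diameter (foldr f w ` C) powr s \<le> (weight r w * d) powr s"
          using wdiam[of w] w s le\<delta>[OF w] by (intro powr_mono2 diameter_ge_0) auto
        also have "\<dots> = d powr s * weight (\<lambda>j. r j powr s) w"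
          using w weight_r_pos[of w] d ratio by (simp add: powr_mult weight_powr[of J] less_imp_le)
        finally show "diam_pow s (foldr f w ` C) \<le> ennreal (d powr s * weight (\<lambda>j. r j powr s) w)"
          using s by (simp add: diam_pow_def ennreal_leI)
      qed
      also have "\<dots> = ennreal (\<Sum>w\<in>words J n. d powr s * weight (\<lambda>j. r j powr s) w)"
        using weight_pos[of J "\<lambda>j. r j powr s"] ratio
        by (intro sum_ennreal mult_nonneg_nonneg) (force intro: less_imp_le)+
      also have "(\<Sum>w\<in>words J n. d powr s * weight (\<lambda>j. r j powr s) w) = d powr s * t ^ n"
        using sum_weight_words[OF finite_J, of "\<lambda>j. r j powr s" n] by (simp add: t_def flip: sum_distrib_left)
      finally show ?thesis .
    qed
    have "(\<lambda>n. b ^ n * d) \<longlonglongrightarrow> 0 * d"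
      using b by (intro tendsto_mult tendsto_const LIMSEQ_power_zero) auto
    then have "eventually (\<lambda>n. b ^ n * d < \<delta>) sequentially"
      by (rule order_tendstoD) (use \<delta> in simp)
    then have "eventually (\<lambda>n. hausdorff_pre_measure s \<delta> C \<le> ennreal (d powr s * t ^ n)) sequentially"
      by eventually_elim (auto intro: bound)
    moreover have "(\<lambda>n. ennreal (d powr s * t ^ n)) \<longlonglongrightarrow> ennreal (d powr s * 0)"
      using t by (intro tendsto_ennrealI tendsto_mult tendsto_const LIMSEQ_power_zero) auto
    ultimately have "hausdorff_pre_measure s \<delta> C \<le> ennreal (d powr s * 0)"
      by (intro tendsto_lowerbound[where F = sequentially]) auto
    then show ?thesis by simp
  qed
  then show ?thesis by (simp add: hausdorff_measure_def)
qed

text \<open>If the ratios summed to less than 1, so would their powers for some exponent below 1, and the dimension would be less than 1.\<close>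

lemma sum_ratios_ge_1:
  assumes C: "compact C" "C = (\<Union>j\<in>J. f j ` C)" and dim: "hausdorff_dim C = 1"
  shows "1 \<le> (\<Sum>j\<in>J. r j)"
proof (rule ccontr)
  assume "\<not> ?thesis"
  then have lt: "(\<Sum>j\<in>J. r j) < 1" by simp
  have one: "(\<Sum>j\<in>J. r j powr 1) = (\<Sum>j\<in>J. r j)"
    using ratio by (intro sum.cong refl powr_one) (simp add: less_imp_le)
  have "((\<lambda>s. \<Sum>j\<in>J. r j powr s) \<longlongrightarrow> (\<Sum>j\<in>J. r j powr 1)) (at_left 1)"
    using ratio by (intro tendsto_sum tendsto_powr tendsto_const tendsto_ident_at) force
  then have "eventually (\<lambda>s. (\<Sum>j\<in>J. r j powr s) < 1) (at_left 1)"
    by (rule order_tendstoD) (simp only: one lt)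
  moreover have "eventually (\<lambda>s. s \<in> {0<..<1}) (at_left (1::real))"
    by (rule eventually_at_left_real) simp
  ultimately have "eventually (\<lambda>s. (\<Sum>j\<in>J. r j powr s) < 1 \<and> s \<in> {0<..<1}) (at_left (1::real))"
    by eventually_elim simp
  then obtain s where s: "(\<Sum>j\<in>J. r j powr s) < 1" "0 < s" "s < 1"
    using eventually_happens'[OF trivial_limit_at_left_real] by (metis (no_types, lifting) greaterThanLessThan_iff)
  have "hausdorff_measure s C = 0" using C lt s by (intro hausdorff_measure_attractor_zero) auto
  then have "hausdorff_dim C \<le> ereal s"
    unfolding hausdorff_dim_def using s by (intro Inf_lower) auto
  then show False using dim s by simp
qed

lemma similarity_exponent_exists:
  assumes sum: "1 \<le> (\<Sum>j\<in>J. r j)" and p: "\<And>j. j \<in> J \<Longrightarrow> r j \<le> p" "0 \<le> p" "p < 1"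
  obtains s where "1 \<le> s" "(\<Sum>j\<in>J. r j powr s) = 1"
proof -
  let ?h = "\<lambda>s. \<Sum>j\<in>J. r j powr s"
  have "(\<lambda>n. real (card J) * p ^ n) \<longlonglongrightarrow> real (card J) * 0"
    using p by (intro tendsto_mult tendsto_const LIMSEQ_power_zero) auto
  then have "eventually (\<lambda>n. real (card J) * p ^ n < 1) sequentially" by (rule order_tendstoD) simp
  then have "eventually (\<lambda>n. real (card J) * p ^ n < 1 \<and> 1 \<le> n) sequentially"
    using eventually_ge_at_top[of 1] by eventually_elim auto
  then obtain n :: nat where n: "real (card J) * p ^ n < 1" "1 \<le> n"
    unfolding eventually_sequentially by blast
  have "?h (real n) \<le> (\<Sum>j\<in>J. p ^ n)"
  proof (rule sum_mono)
    fix j assume j: "j \<in> J"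
    then have "r j ^ n \<le> p ^ n" using ratio[OF j] p(1)[OF j] by (intro power_mono) auto
    then show "r j powr real n \<le> p ^ n" using ratio[OF j] by (simp add: powr_realpow)
  qed
  then have "?h (real n) \<le> 1" using n by simp
  moreover have "?h 1 = (\<Sum>j\<in>J. r j)"
    using ratio by (intro sum.cong refl powr_one) (simp add: less_imp_le)
  then have "1 \<le> ?h 1" using sum by (simp only:)
  moreover have "continuous_on {1..real n} ?h"
    using ratio by (intro continuous_intros) force
  ultimately obtain s where "1 \<le> s" "s \<le> real n" "?h s = 1"
    using IVT2'[of ?h "real n" 1 1] n by auto
  then show ?thesis using that by blast
qed

end

section \<open>The word length for a given accuracy\<close>

lemma logarithm_below_linear:
  fixes P c \<mu> :: real
  assumes P: "0 \<le> P" and \<mu>: "0 < \<mu>"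
  obtains b where "1 \<le> b" "P * ln (b + 2) + c \<le> (b * \<mu> - 2 * P) / 2" "0 \<le> b * \<mu> - 2 * P"
proof -
  \<comment> \<open>With this \<open>\<delta>\<close> the tangent bound \<open>ln x \<le> \<delta> * x - 1 - ln \<delta>\<close> has slope at most \<open>\<mu> / 4\<close> after multiplication by \<open>P\<close>.\<close>
  define \<delta> where "\<delta> = \<mu> / (4 * (P + 1))"
  have \<delta>: "0 < \<delta>" using P \<mu> by (simp add: \<delta>_def)
  have P\<delta>: "P * \<delta> \<le> \<mu> / 4" using P \<mu> by (simp add: \<delta>_def field_simps)
  define Z where "Z = P * \<bar>ln \<delta>\<bar>"
  define X where "X = \<mu> / 2 + P * \<bar>ln \<delta>\<bar> + \<bar>c\<bar> + P"
  have X: "0 \<le> X" using P \<mu> by (simp add: X_def)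
  define b where "b = 1 + 4 * X / \<mu>"
  have b1: "1 \<le> b" using X \<mu> by (simp add: b_def)
  have "b * \<mu> = \<mu> + 4 * X" using \<mu> by (simp add: b_def distrib_right)
  then have "X \<le> b * \<mu> / 4" using \<mu> by linarith
  then have b: "\<mu> / 2 + P * \<bar>ln \<delta>\<bar> + \<bar>c\<bar> + P \<le> b * \<mu> / 4" by (simp only: X_def)
  have "ln (\<delta> * (b + 2)) \<le> \<delta> * (b + 2) - 1" using \<delta> b1 by (intro ln_le_minus_one mult_pos_pos) auto
  then have "ln (b + 2) \<le> \<delta> * (b + 2) + \<bar>ln \<delta>\<bar>" using \<delta> b1 by (simp add: ln_mult)
  then have "P * ln (b + 2) \<le> P * (\<delta> * (b + 2) + \<bar>ln \<delta>\<bar>)" using P by (rule mult_left_mono)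
  moreover have "P * (\<delta> * (b + 2) + \<bar>ln \<delta>\<bar>) = (P * \<delta>) * (b + 2) + P * \<bar>ln \<delta>\<bar>" by (simp add: algebra_simps)
  moreover have "(P * \<delta>) * (b + 2) \<le> \<mu> / 4 * (b + 2)" using P\<delta> b1 by (intro mult_right_mono) auto
  moreover have "\<mu> / 4 * (b + 2) = b * \<mu> / 4 + \<mu> / 2" by (simp add: algebra_simps)
  ultimately have "P * ln (b + 2) + c \<le> (b * \<mu> - 2 * P) / 2" using b abs_ge_self[of c] unfolding Z_def[symmetric] by argo
  moreover have "0 \<le> b * \<mu> - 2 * P"
  proof -
    have "0 \<le> P * \<bar>ln \<delta>\<bar>" using P by simp
    then show ?thesis using b P \<mu> by linarith
  qed
  ultimately show ?thesis using b1 that by blast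
qed

text \<open>A loss of order \<open>ln n\<close> against a gain of order \<open>\<epsilon> * n\<close> is affordable once \<open>n\<close> is a large multiple of
\<open>inverse \<epsilon> * ln (inverse \<epsilon>)\<close>. The bound \<open>\<epsilon> \<le> 1/2\<close> keeps the logarithm away from 0.\<close>

lemma word_length_for_accuracy:
  fixes P c \<mu> :: real
  assumes P: "0 \<le> P" and \<mu>: "0 < \<mu>"
  obtains B where "0 < B" "\<And>\<epsilon>. 0 < \<epsilon> \<Longrightarrow> \<epsilon> \<le> 1/2 \<Longrightarrow>
    \<exists>n\<ge>1. real n \<le> B * inverse \<epsilon> * ln (inverse \<epsilon>) \<and> P * ln (real n + 1) + c \<le> \<epsilon> * real n * \<mu>"
proof -
  obtain b where b: "1 \<le> b" "P * ln (b + 2) + c \<le> (b * \<mu> - 2 * P) / 2" "0 \<le> b * \<mu> - 2 * P"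
    using logarithm_below_linear[OF P \<mu>] .
  have "\<exists>n\<ge>1. real n \<le> (b + 1) * inverse \<epsilon> * ln (inverse \<epsilon>) \<and> P * ln (real n + 1) + c \<le> \<epsilon> * real n * \<mu>"
    if \<epsilon>: "0 < \<epsilon>" "\<epsilon> \<le> 1/2" for \<epsilon> :: real
  proof -
    define x where "x = inverse \<epsilon>"
    have x: "2 \<le> x" "\<epsilon> * x = 1" using \<epsilon> by (auto simp: x_def field_simps)
    have "ln 2 \<le> ln x" using x by (intro ln_mono) auto
    then have lx: "1/2 \<le> ln x" using ln2_ge_two_thirds by linarith
    have xl: "1 \<le> x * ln x" using mult_mono[of 2 x "1/2" "ln x"] x lx by simp
    have xx: "x * ln x \<le> x * x" using x ln_le_minus_one[of x] by (intro mult_left_mono) auto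
    define n where "n = nat \<lceil>b * (x * ln x)\<rceil>"
    have bxl: "1 \<le> b * (x * ln x)" using mult_mono[of 1 b 1 "x * ln x"] b xl by simp
    have n: "b * (x * ln x) \<le> real n" "real n \<le> b * (x * ln x) + 1" using bxl by (simp_all add: n_def)
    have n1: "n \<ge> 1" using n(1) bxl by linarith
    have nB: "real n \<le> (b + 1) * x * ln x" using n(2) xl by (simp add: algebra_simps)
    have "real n + 1 \<le> (b + 2) * (x * x)"
    proof -
      have "1 \<le> x * x" using xl xx by linarith
      moreover have "b * (x * ln x) \<le> b * (x * x)" using xx by (rule mult_left_mono) (use b(1) in simp)
      ultimately show ?thesis using n(2) by (simp add: algebra_simps)
    qed
    then have "ln (real n + 1) \<le> ln ((b + 2) * (x * x))" by (intro ln_mono) auto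
    also have "\<dots> = ln (b + 2) + 2 * ln x" using x b by (simp add: ln_mult)
    finally have "P * ln (real n + 1) \<le> P * (ln (b + 2) + 2 * ln x)" using P by (rule mult_left_mono)
    then have "P * ln (real n + 1) + c \<le> (b * \<mu> - 2 * P) * (1/2) + 2 * P * ln x" using b(2) by (simp add: algebra_simps)
    also have "\<dots> \<le> (b * \<mu> - 2 * P) * ln x + 2 * P * ln x" using b(3) lx by (intro add_right_mono mult_left_mono) auto
    also have "\<dots> = \<mu> * (\<epsilon> * (b * (x * ln x)))"
      using x(2) by (simp add: algebra_simps)
    also have "\<dots> \<le> \<mu> * (\<epsilon> * real n)" using n(1) \<mu> \<epsilon> by (intro mult_left_mono) auto
    finally have "P * ln (real n + 1) + c \<le> \<epsilon> * real n * \<mu>" by (simp add: mult_ac)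
    then show ?thesis using n1 nB unfolding x_def by blast
  qed
  then show ?thesis using that[of "b + 1"] b by auto
qed

section \<open>Lipschitz graphs in self-similar sets\<close>

context osc_system
begin

text \<open>A class of words of length \<open>n\<close> with common linear part has \<open>\<rho> powr (- s)\<close> members and energy
\<open>\<rho> powr (- s)\<close>, both up to powers of \<open>n\<close>. The packing numbers are therefore of order \<open>1 / \<rho>\<close> on average, whatever \<open>s \<ge> 1\<close>
is, up to a power of \<open>n\<close>, whose logarithm is what the hypothesis compares with \<open>\<epsilon> * ln (1 / \<rho>)\<close>.\<close>

lemma lipschitz_graphs_in_attractor:
  assumes C: "compact C"
  obtains c\<^sub>0 where "\<And>n \<epsilon>. \<lbrakk>1 \<le> n; \<epsilon> < 1; real (card J + 1) * ln (real n + 1) + c\<^sub>0 \<le> \<epsilon> * real n * ln (1 / p)\<rbrakk>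
     \<Longrightarrow> \<exists>\<Gamma> \<theta> A g. \<Gamma> \<subseteq> C \<and> lipschitz_graph \<theta> A g \<Gamma> \<and> ereal (1 - \<epsilon>) \<le> hausdorff_dim \<Gamma> \<and> Lip A g \<le> (1 / q) ^ n"
proof -
  obtain K where K: "0 < K" "\<forall>n T \<rho>. 1 \<le> n \<longrightarrow> T \<subseteq> words J n \<longrightarrow> (\<forall>w\<in>T. weight r w = \<rho>) \<longrightarrow>
      (\<forall>v\<in>T. (\<Sum>w\<in>T - {v}. 1 / dist (centre v) (centre w)) \<le> K * real n * \<rho> powr (- s))"
    using energy_bound by blast
  define K' where "K' = 1 + 52 * D * K"
  have K': "K' > 0" using K(1) D by (simp add: K'_def add_pos_nonneg)
  define c\<^sub>0 where "c\<^sub>0 = ln (2 * K') + 1"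
  have "\<exists>\<Gamma> \<theta> A g. \<Gamma> \<subseteq> C \<and> lipschitz_graph \<theta> A g \<Gamma> \<and> ereal (1 - \<epsilon>) \<le> hausdorff_dim \<Gamma> \<and> Lip A g \<le> (1 / q) ^ n"
    if n: "1 \<le> n" and \<epsilon>: "\<epsilon> < 1" and large: "real (card J + 1) * ln (real n + 1) + c\<^sub>0 \<le> \<epsilon> * real n * ln (1 / p)" for n \<epsilon>
  proof -
    obtain T \<rho> R where T: "T \<subseteq> words J n" "T \<noteq> {}" "\<forall>w\<in>T. weight r w = \<rho>" "\<forall>w\<in>T. rot w = R"
      "1 \<le> real (card T) * \<rho> powr s * real ((n + 1) ^ card J)" "q ^ n \<le> \<rho>" "\<rho> \<le> p ^ n" "rotation_matrix R"
      using homothetic_words[OF n] .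
    have \<rho>: "0 < \<rho>" using zero_less_power[OF qp(1), of n] T(6) by linarith
    have p: "0 < p"
    proof -
      obtain j where j: "j \<in> J" using s(2) by fastforce
      show ?thesis using qp(4)[OF j] ratio[OF j] by simp
    qed
    have \<rho>1: "\<rho> < 1"
    proof -
      have "p ^ n \<le> p ^ 1" using p qp(2) n by (intro power_decreasing) auto
      then show ?thesis using T(7) qp(2) by simp
    qed
    have TJ: "set w \<subseteq> J" if "w \<in> T" for w using T(1) that by auto
    interpret H: homothetic_family T "foldr f" R C a \<rho> D
    proof
      show "finite T" using T(1) finite_words[OF finite_J] by (rule finite_subset)
      show "foldr f w x - foldr f w y = \<rho> *\<^sub>R (R *v (x - y))" if "w \<in> T" for w x y
        using word_similarity[OF TJ[OF that]] T(3,4) that by simp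
      show "orthogonal_matrix R" using T(8) by (simp add: rotation_matrix_def)
      show "foldr f w ` C \<subseteq> C" if "w \<in> T" for w
        using word_invariant[OF inv_C TJ[OF that]] by blast
    qed (use \<rho> \<rho>1 C C_nonempty near_C D in auto)
    have "\<exists>\<Gamma> \<theta> A g. \<Gamma> \<subseteq> C \<and> lipschitz_graph \<theta> A g \<Gamma> \<and> ereal (1 - \<epsilon>) \<le> hausdorff_dim \<Gamma> \<and> Lip A g \<le> 1 / \<rho>"
    proof (rule H.lipschitz_graph_from_energy[OF T(2)])
      show "foldr f v a \<noteq> foldr f w a \<and> dist (foldr f v a) (foldr f w a) \<le> 4 * D"
        if "v \<in> T" "w \<in> T" "v \<noteq> w" for v w
      proof -
        have "0 < c * \<rho>" using c \<rho> by simp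
        then have "0 < dist (centre v) (centre w)" "dist (centre v) (centre w) \<le> 4 * D"
          using distinct_centres[OF T(1) bspec[OF T(3)] that] by linarith+
        then show ?thesis by (auto simp: centre_def)
      qed
      show "(\<Sum>w\<in>T - {v}. 1 / dist (foldr f v a) (foldr f w a)) \<le> K * real n * \<rho> powr (- s)" if "v \<in> T" for v
        using K(2) n T(1,3) that unfolding centre_def by blast
      show "0 < 1 - \<epsilon>" using \<epsilon> by simp
      define M where "M = real (card T)"
      define m where "m = real n + 1"
      have m: "1 \<le> m" by (simp add: m_def)
      have M: "1 \<le> M * \<rho> powr s * m ^ card J" using T(5) by (simp add: M_def m_def add.commute)
      have \<rho>s: "1 \<le> \<rho> powr (1 - s)" using \<rho> \<rho>1 s powr_mono'[of "1 - s" 0 \<rho>] by simp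
      have "1 + 52 * D * \<rho> * (K * real n * \<rho> powr (- s)) = 1 + 52 * D * K * (real n * \<rho> powr (1 - s))"
        using \<rho> by (simp add: powr_diff powr_minus_divide)
      also have "\<dots> \<le> K' * (m * \<rho> powr (1 - s))"
      proof -
        have "1 * 1 \<le> m * \<rho> powr (1 - s)" using m \<rho>s by (intro mult_mono) auto
        moreover have "52 * D * K * (real n * \<rho> powr (1 - s)) \<le> 52 * D * K * (m * \<rho> powr (1 - s))"
          using D K(1) by (intro mult_left_mono mult_right_mono) (auto simp: m_def)
        ultimately show ?thesis by (simp add: K'_def distrib_right)
      qed
      finally have E: "1 + 52 * D * \<rho> * (K * real n * \<rho> powr (- s)) \<le> K' * (m * \<rho> powr (1 - s))" .
      have E0: "0 < 1 + 52 * D * \<rho> * (K * real n * \<rho> powr (- s))"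
        using D \<rho> K(1) by (intro add_pos_nonneg) auto
      have big: "1 / \<rho> / (2 * K' * m ^ (card J + 1)) \<le> M / (2 * (1 + 52 * D * \<rho> * (K * real n * \<rho> powr (- s))))"
      proof -
        have "1 / (\<rho> powr s * m ^ card J) \<le> M" using M \<rho> m by (simp add: divide_le_eq mult.assoc)
        then have "1 / (\<rho> powr s * m ^ card J) / (2 * (K' * (m * \<rho> powr (1 - s)))) \<le> M / (2 * (1 + 52 * D * \<rho> * (K * real n * \<rho> powr (- s))))"
          using E E0 by (intro frac_le) (auto simp: M_def)
        moreover have "1 / (\<rho> powr s * m ^ card J) / (2 * (K' * (m * \<rho> powr (1 - s)))) = 1 / \<rho> / (2 * K' * m ^ (card J + 1))"
        proof -
          have "\<rho> powr s * \<rho> powr (1 - s) = \<rho>" using \<rho> by (simp flip: powr_add)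
          then have "(\<rho> powr s * m ^ card J) * (2 * (K' * (m * \<rho> powr (1 - s)))) = \<rho> * (2 * K' * m ^ (card J + 1))"
            by (simp add: mult_ac)
          then show ?thesis by (simp only: divide_divide_eq_left)
        qed
        ultimately show ?thesis by (simp only:)
      qed
      have "ln (1 / \<rho> / (2 * K' * m ^ (card J + 1))) = ln (1 / \<rho>) - (ln (2 * K') + real (card J + 1) * ln m)"
      proof -
        have "ln (1 / \<rho> / (2 * K' * m ^ (card J + 1))) = ln (1 / \<rho>) - ln (2 * K' * m ^ (card J + 1))"
          using \<rho> K' m by (intro ln_divide_pos) auto
        also have "ln (2 * K' * m ^ (card J + 1)) = ln (2 * K') + ln (m ^ (card J + 1))"
          using K' m by (intro ln_mult_pos) auto
        also have "ln (m ^ (card J + 1)) = real (card J + 1) * ln m" by (rule ln_realpow)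
        finally show ?thesis .
      qed
      moreover have "\<epsilon> * real n * ln (1 / p) \<le> \<epsilon> * ln (1 / \<rho>)"
      proof -
        have "real n * ln (1 / p) = ln ((1 / p) ^ n)" by (rule ln_realpow[symmetric])
        also have "\<dots> \<le> ln (1 / \<rho>)"
          using p \<rho> T(7) by (intro ln_mono) (auto simp: power_one_over intro!: divide_left_mono)
        finally have nl: "real n * ln (1 / p) \<le> ln (1 / \<rho>)" .
        have "0 \<le> \<epsilon>"
        proof (rule ccontr)
          assume "\<not> 0 \<le> \<epsilon>"
          moreover have "0 < real n * ln (1 / p)" using p qp(2) n by (intro mult_pos_pos ln_gt_zero) auto
          ultimately have "\<epsilon> * (real n * ln (1 / p)) < 0" by (intro mult_neg_pos) auto
          then have "\<epsilon> * real n * ln (1 / p) < 0" by (simp only: mult.assoc)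
          moreover have "0 \<le> real (card J + 1) * ln (real n + 1)" by (intro mult_nonneg_nonneg) auto
          moreover have "0 \<le> c\<^sub>0"
          proof -
            have "1 \<le> 2 * K'" using K(1) D by (simp add: K'_def)
            then show ?thesis by (simp add: c\<^sub>0_def)
          qed
          ultimately show False using large by linarith
        qed
        then show ?thesis using mult_left_mono[OF nl, of \<epsilon>] by (simp only: mult.assoc)
      qed
      moreover have "ln (1 / \<rho> / (2 * K' * m ^ (card J + 1))) \<le> ln (M / (2 * (1 + 52 * D * \<rho> * (K * real n * \<rho> powr (- s)))))"
        using big \<rho> K' m by (intro ln_mono) auto
      ultimately show "(1 - \<epsilon>) * ln (1 / \<rho>) + 1 \<le> ln (real (card T) / (2 * (1 + 52 * D * \<rho> * (K * real n * \<rho> powr (- s)))))"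
        using large by (simp add: M_def m_def c\<^sub>0_def left_diff_distrib)
    qed
    moreover have "1 / \<rho> \<le> (1 / q) ^ n"
      using T(6) qp(1) by (simp add: power_one_over frac_le)
    ultimately show ?thesis by (meson order_trans)
  qed
  then show ?thesis using that by blast
qed

end

theorem theorem2p10:
  fixes N :: nat and f :: "nat \<Rightarrow> real^2 \<Rightarrow> real^2" and C :: "(real^2) set"
  assumes "ifs N f"
    and "open_set_condition N f"
    and "attractor N f C"
    and "hausdorff_dim C = 1"
  shows "\<exists>b1 b2 :: real. \<forall>\<epsilon>::real. \<epsilon> > 0 \<longrightarrow>
           (\<exists>\<Gamma> \<theta> A g. lipschitz_graph \<theta> A g \<Gamma> \<and>
              hausdorff_dim (C \<inter> \<Gamma>) \<ge> ereal (1 - \<epsilon>) \<and>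
              Lip A g \<le> b1 * exp (b2 * inverse \<epsilon> * ln (inverse \<epsilon>)))"
proof -
  define J where "J = {1..N}"
  have C: "C \<noteq> {}" "compact C" "C = (\<Union>j\<in>J. f j ` C)" using assms(3) by (auto simp: attractor_def J_def)
  obtain r A z where rAz: "\<And>j. j \<in> J \<Longrightarrow> 0 < r j \<and> r j < 1 \<and> rotation_matrix (A j) \<and> (\<forall>x. f j x = r j *\<^sub>R (A j *v x) + z j)"
    using assms(1) unfolding ifs_def J_def[symmetric] by metis
  have J: "finite J" "J \<noteq> {}" using C by (auto simp: J_def)
  interpret S: similarity_system J f r A
    using J rAz by unfold_locales (auto simp: matrix_vector_mult_diff_distrib scaleR_diff_right)
  define p where "p = Max (r ` J)"
  define q where "q = Min (r ` J)"
  have pq: "q \<le> r j" "r j \<le> p" if "j \<in> J" for j using that J by (auto simp: p_def q_def)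
  have "p \<in> r ` J" "q \<in> r ` J" using J by (auto simp: p_def q_def intro!: Max_in Min_in)
  then have pq01: "0 < p" "p < 1" "0 < q" "q < 1" using rAz by auto
  obtain s where s: "1 \<le> s" "(\<Sum>j\<in>J. r j powr s) = 1"
    using S.similarity_exponent_exists[OF S.sum_ratios_ge_1[OF C(2,3) assms(4)] pq(2)] pq01 by auto
  obtain U where U: "U \<noteq> {}" "open U" "(\<Union>j\<in>J. f j ` U) \<subseteq> U"
    "\<And>i j. i \<in> J \<Longrightarrow> j \<in> J \<Longrightarrow> i \<noteq> j \<Longrightarrow> f i ` U \<inter> f j ` U = {}"
    using assms(2) unfolding open_set_condition_def J_def[symmetric] by metis
  obtain a c' where a: "c' > 0" "ball a c' \<subseteq> U" using U(1,2) by (meson all_not_in_conv open_contains_ball)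
  obtain D' where D': "\<And>x. x \<in> C \<Longrightarrow> dist a x \<le> D'"
    using compact_imp_bounded[OF C(2)] by (auto simp: bounded_any_center[where a = a])
  interpret O: osc_system J f r A U C a "min c' 1" "max D' 1" s q p
  proof
    show "f j ` U \<subseteq> U" if "j \<in> J" for j using U(3) that by blast
    show "f j ` C \<subseteq> C" if "j \<in> J" for j using C(3) that by blast
    show "dist a x \<le> max D' 1" if "x \<in> C" for x using D'[OF that] by simp
  qed (use U(4) a C(1) s pq pq01 in auto)
  obtain c\<^sub>0 where graphs: "\<And>n \<epsilon>. \<lbrakk>1 \<le> n; \<epsilon> < 1; real (card J + 1) * ln (real n + 1) + c\<^sub>0 \<le> \<epsilon> * real n * ln (1 / p)\<rbrakk>
     \<Longrightarrow> \<exists>\<Gamma> \<theta> A g. \<Gamma> \<subseteq> C \<and> lipschitz_graph \<theta> A g \<Gamma> \<and> ereal (1 - \<epsilon>) \<le> hausdorff_dim \<Gamma> \<and> Lip A g \<le> (1 / q) ^ n"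
    using O.lipschitz_graphs_in_attractor[OF C(2)] by blast
  have "0 < ln (1 / p)" using pq01 by (intro ln_gt_zero) auto
  then obtain B where B: "0 < B" "\<And>\<epsilon>. 0 < \<epsilon> \<Longrightarrow> \<epsilon> \<le> 1/2 \<Longrightarrow>
    \<exists>n\<ge>1. real n \<le> B * inverse \<epsilon> * ln (inverse \<epsilon>) \<and> real (card J + 1) * ln (real n + 1) + c\<^sub>0 \<le> \<epsilon> * real n * ln (1 / p)"
    using word_length_for_accuracy[of "real (card J + 1)" "ln (1 / p)" c\<^sub>0] by (metis of_nat_0_le_iff)
  define b2 where "b2 = B * ln (1 / q)"
  have lq: "0 < ln (1 / q)" using pq01 by (intro ln_gt_zero) auto
  have b2: "0 < b2" using B(1) lq by (simp add: b2_def)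
  have small: "\<exists>\<Gamma> \<theta> A g. lipschitz_graph \<theta> A g \<Gamma> \<and> ereal (1 - \<epsilon>) \<le> hausdorff_dim (C \<inter> \<Gamma>) \<and>
      Lip A g \<le> exp (b2 * inverse \<epsilon> * ln (inverse \<epsilon>))" if \<epsilon>: "0 < \<epsilon>" "\<epsilon> \<le> 1/2" for \<epsilon>
  proof -
    obtain n where n: "n \<ge> 1" "real n \<le> B * inverse \<epsilon> * ln (inverse \<epsilon>)"
      "real (card J + 1) * ln (real n + 1) + c\<^sub>0 \<le> \<epsilon> * real n * ln (1 / p)"
      using B(2)[OF \<epsilon>] by blast
    obtain \<Gamma> \<theta> A g where \<Gamma>: "\<Gamma> \<subseteq> C" "lipschitz_graph \<theta> A g \<Gamma>" "ereal (1 - \<epsilon>) \<le> hausdorff_dim \<Gamma>" "Lip A g \<le> (1 / q) ^ n"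
      using graphs[OF n(1) _ n(3)] \<epsilon> by force
    have "(1 / q) ^ n = exp (real n * ln (1 / q))" using pq01 by (simp add: exp_of_nat_mult)
    also have "\<dots> \<le> exp (b2 * inverse \<epsilon> * ln (inverse \<epsilon>))"
      using mult_right_mono[OF n(2), of "ln (1 / q)"] lq by (simp add: b2_def mult_ac)
    finally have "Lip A g \<le> exp (b2 * inverse \<epsilon> * ln (inverse \<epsilon>))" using \<Gamma>(4) by linarith
    moreover have "C \<inter> \<Gamma> = \<Gamma>" using \<Gamma>(1) by blast
    ultimately show ?thesis using \<Gamma>(2,3) by metis
  qed
  \<comment> \<open>For \<open>1/2 < \<epsilon> < 1\<close> the graph found for \<open>1/2\<close> is used, and \<open>b1\<close> is its bound.\<close>
  define b1 where "b1 = exp (b2 * 2 * ln 2)"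
  have b1: "1 \<le> b1" using b2 by (simp add: b1_def)
  show ?thesis
  proof (rule exI[of _ b1], rule exI[of _ b2], intro allI impI)
    fix \<epsilon> :: real assume \<epsilon>: "\<epsilon> > 0"
    let ?e = "exp (b2 * inverse \<epsilon> * ln (inverse \<epsilon>))"
    consider "\<epsilon> \<le> 1/2" | "1/2 < \<epsilon>" "\<epsilon> < 1" | "1 \<le> \<epsilon>" by linarith
    then show "\<exists>\<Gamma> \<theta> A g. lipschitz_graph \<theta> A g \<Gamma> \<and> hausdorff_dim (C \<inter> \<Gamma>) \<ge> ereal (1 - \<epsilon>) \<and> Lip A g \<le> b1 * ?e"
    proof cases
      case 1
      have "?e \<le> b1 * ?e" using b1 by simp
      then show ?thesis using small[OF \<epsilon> 1] by (meson order_trans)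
    next
      case 2
      obtain \<Gamma> \<theta> A g where \<Gamma>: "lipschitz_graph \<theta> A g \<Gamma>" "ereal (1 - 1/2) \<le> hausdorff_dim (C \<inter> \<Gamma>)"
        "Lip A g \<le> exp (b2 * inverse (1/2) * ln (inverse (1/2)))"
        using small[of "1/2"] by auto
      have "0 \<le> ln (inverse \<epsilon>)" using 2 \<epsilon> by (intro ln_ge_zero) (simp add: one_le_inverse)
      then have "1 \<le> ?e" using b2 \<epsilon> by simp
      then have "b1 \<le> b1 * ?e" using b1 by simp
      moreover have "Lip A g \<le> b1" using \<Gamma>(3) by (simp add: b1_def)
      ultimately have "Lip A g \<le> b1 * ?e" by linarith
      moreover have "ereal (1 - \<epsilon>) \<le> ereal (1 - 1/2)" using 2 by simp
      ultimately show ?thesis using \<Gamma>(1,2) by (meson order_trans)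
    next
      case 3
      have "0-lipschitz_on {} (\<lambda>_::real. 0::real)" by (rule lipschitz_onI) auto
      then have "lipschitz_graph 0 {} (\<lambda>_. 0) {}" "Lip {} (\<lambda>_. 0) \<le> 0"
        by (auto simp: lipschitz_graph_def graph_over_def Lip_def intro!: cInf_lower bdd_belowI[of _ 0] dest: lipschitz_on_nonneg)
      moreover have "0 \<le> b1 * ?e" using b1 by simp
      moreover have "ereal (1 - \<epsilon>) \<le> 0" using 3 by simp
      moreover have "0 \<le> hausdorff_dim (C \<inter> {})" unfolding hausdorff_dim_def by (rule Inf_greatest) auto
      ultimately show ?thesis by (meson order_trans)
    qed
  qed
qed

end
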